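(* Let $d\ge 3$ and let $\mu$ be the normalized surface measure on the manifold $M$ of equilateral triangles. Then for all multi-indices $\alpha,\beta$ there is a constant $C_{\alpha,\beta}$ such that for all $\xi,\eta\in\mathbb{R}^d$, $$\left|\partial_\xi^\alpha\partial_\eta^\beta\widehat{\mu}(\xi,\eta)\right|\le C_{\alpha,\beta}\left(1+\min\{|\xi|,|\eta|\}\,|\sin\theta|\right)^{-\frac{d-2}{2}}\left(1+|(\xi,\eta)|\right)^{-\frac{d-2}{2}},$$ where $\theta$ is the angle between $\xi$ and $\eta$.
   Context: Here $M=\{(u,v)\in\mathbb{R}^d\times\mathbb{R}^d : |u|=|v|=|u-v|=1\}$, a compact submanifold of $\mathbb{R}^{2d}$, and $\mu$ is its surface measure normalized to be a probability measure. The Fourier transform is $\widehat{\mu}(\xi,\eta)=\int_M e^{-2\pi i(\xi\cdot u+\eta\cdot v)}\,d\mu(u,v)$. When $\xi=0$ or $\eta=0$ the angle is undefined, and the quantity $\min\{|\xi|,|\eta|\}|\sin\theta|$ is read as $0$. *)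

theory Defs
  imports "HOL-Analysis.Analysis"
begin

(* s-dimensional Hausdorff measure of a set.  The empty set contributes 0 also for s = 0, whereas a
   singleton contributes 0 ^ s, i.e. 1 for s = 0.  Boundedness is required because
   diameter is a real number with an unspecified value on unbounded sets. *)

definition hausdorff_pre :: "nat \<Rightarrow> real \<Rightarrow> 'a::metric_space set \<Rightarrow> ennreal" where
  "hausdorff_pre s \<delta> A =
     (INF U \<in> {U :: nat \<Rightarrow> 'a set. A \<subseteq> (\<Union>i. U i) \<and> (\<forall>i. bounded (U i) \<and> diameter (U i) \<le> \<delta>)}.
        \<Sum>i. if U i = {} then 0 else ennreal (diameter (U i) ^ s))"

(* The factor in front makes the s-dimensional Hausdorff measure agree with Lebesgue measure on
   s-dimensional Euclidean space, hence with the Riemannian surface measure on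
   s-dimensional submanifolds. *)

definition hausdorff_outer :: "nat \<Rightarrow> 'a::metric_space set \<Rightarrow> ennreal" where
  "hausdorff_outer s A =
     ennreal (unit_ball_vol (real s) / 2 ^ s) * (SUP \<delta> \<in> {0<..}. hausdorff_pre s \<delta> A)"

(* By Caratheodory's criterion the outer measure is countably additive on Borel sets, so that
   measure_of does not fall back to the null measure. *)

definition hausdorff_measure :: "nat \<Rightarrow> 'a::metric_space measure" where
  "hausdorff_measure s = measure_of UNIV (sets borel) (hausdorff_outer s)"

definition triangles :: "((real^'n) \<times> (real^'n)) set" where
  "triangles = {(u, v). norm u = 1 \<and> norm v = 1 \<and> norm (u - v) = 1}"

(* For d = CARD('n) \<ge> 2 the manifold has dimension (d - 1) + (d - 2) = 2 * d - 3; its surface measure is the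
   Hausdorff measure of that dimension, which uniform_measure restricts to the manifold and
   normalizes to total mass 1. *)

definition triangle_measure :: "((real^'n) \<times> (real^'n)) measure" where
  "triangle_measure = uniform_measure (hausdorff_measure (2 * CARD('n) - 3)) triangles"

definition fourier :: "'a::euclidean_space measure \<Rightarrow> 'a \<Rightarrow> complex" where
  "fourier \<mu> \<zeta> = (\<integral>x. exp (- (2 * complex_of_real pi * \<i> * complex_of_real (\<zeta> \<bullet> x))) \<partial>\<mu>)"

definition partial_deriv ::
  "'a::real_normed_vector \<Rightarrow> ('a \<Rightarrow> complex) \<Rightarrow> 'a \<Rightarrow> complex" where
  "partial_deriv b f x = vector_derivative (\<lambda>t. f (x + t *\<^sub>R b)) (at 0)"

(* A multi-index is a function \<alpha> on the finite index type; the partial derivative in direction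
   e i is taken \<alpha> i times.  The index type carries no order, so the partial
   derivatives are composed along some fixed enumeration of it; the order is immaterial for
   smooth functions. *)

definition multi_deriv ::
  "('i::finite \<Rightarrow> 'a::real_normed_vector) \<Rightarrow> ('i \<Rightarrow> nat) \<Rightarrow> ('a \<Rightarrow> complex) \<Rightarrow> 'a \<Rightarrow> complex" where
  "multi_deriv e \<alpha> f =
     fold (\<lambda>i. partial_deriv (e i) ^^ \<alpha> i) (SOME is. distinct is \<and> set is = (UNIV :: 'i set)) f"

definition deriv_xi ::
  "('n::finite \<Rightarrow> nat) \<Rightarrow> ((real^'n) \<times> (real^'n) \<Rightarrow> complex) \<Rightarrow> (real^'n) \<times> (real^'n) \<Rightarrow> complex" where
  "deriv_xi = multi_deriv (\<lambda>i. (axis i 1, 0))"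

definition deriv_eta ::
  "('n::finite \<Rightarrow> nat) \<Rightarrow> ((real^'n) \<times> (real^'n) \<Rightarrow> complex) \<Rightarrow> (real^'n) \<times> (real^'n) \<Rightarrow> complex" where
  "deriv_eta = multi_deriv (\<lambda>i. (0, axis i 1))"

(* If one of the vectors is 0 the value is pi / 2; it only ever occurs multiplied by
   the smaller of the two norms, which then vanishes. *)

definition angle :: "'a::real_inner \<Rightarrow> 'a \<Rightarrow> real" where
  "angle \<xi> \<eta> = arccos ((\<xi> \<bullet> \<eta>) / (norm \<xi> * norm \<eta>))"

end

(* The normalized Hausdorff measure on the triangles is invariant under the isometries (u, v) -> (g u, g v)
   with g orthogonal and under (u, v) -> (v, u).  If the Hausdorff measure of the manifold were 0 or infinite,
   the normalized measure would be null, so nothing needs to be known about its size.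

   Write eta = gamma n with |n| = 1 and N = (d - 2) / 2.  Averaging xi over its orbit under the rotations that
   fix n, then n over the unit sphere, then v over the unit vectors at angle pi / 3 to u, bounds the Fourier
   transform by an average of F(beta rho) F(gamma rho sqrt 3 / 2), where beta is the length of the part of xi
   orthogonal to n, rho is the sine of the angle between a random unit vector and a fixed one, and F is the
   Fourier transform of the unit sphere of dimension d - 2.  Invariance under rotations gives the
   Bessel equation F'' + (d - 2) F' / r + F = 0, whence F(r) = O((1 + r) powr - N) by an energy estimate, and it gives
   that rho powr (- 2 N) has finite mean.  Hence the Fourier transform is
   O((1 + |xi| + |eta| + |xi| |eta| |sin theta|) powr - N).

   Since |u|^2 + |v|^2 = 2 on the manifold, the measure is a constant multiple of the product of itself and a
   Gaussian, so its Fourier transform is a convolution with a Gaussian, and differentiating the Gaussian instead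
   gives the bounds for the derivatives. *)

theory Submission
  imports Defs "HOL-Probability.Probability"
begin

section \<open>The normalized Hausdorff measure on the triangles\<close>

text \<open>All averages are taken against the measure at hand: its first marginal \<nu> stands for
  the uniform distribution on the unit sphere, and the image under \<open>perp_dir n\<close> of
  \<nu> weighted by \<open>sin2 n\<close> for the one on the unit sphere orthogonal to n. Each
  average contributes a mass that may be 0, so the estimates stay multiplied out until
  \<open>char_fun_decay_half\<close> splits off that case.

  The two vectors of a triangle are coupled, so v cannot be averaged independently of u. Once n has
  become an integration variable z with law \<nu>, the triangle is held fixed and the part of v
  orthogonal to u is turned by turning z instead, for each triangle separately.

  The product of the two factors F is at most a multiple of (beta gamma) powr (- N) * rho powr (2 -
  d). The law of rho has density of order rho powr (d - 2) near 0, so averaging keeps the full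
  decay.

  The Gaussian convolution preserves the bound because a shift by s along a coordinate axis changes
  1 + |xi| + |eta| + |xi| |eta| |sin theta| by a factor of at most 1 + |s|, which Gaussian moments
  absorb.\<close>

lemma diameter_isometry_image:
  assumes "\<And>x y. dist (f x) (f y) = dist x y"
  shows "diameter (f ` A) = diameter A"
proof -
  have "f ` A \<times> f ` A = map_prod f f ` (A \<times> A)"
    by (simp add: map_prod_surj_on)
  then have "(\<lambda>(x, y). dist x y) ` (f ` A \<times> f ` A) = (\<lambda>(x, y). dist x y) ` (A \<times> A)"
    by (simp add: image_image split_beta assms)
  then show ?thesis
    unfolding diameter_def by simp
qed

text \<open>An isometry carries each admissible cover of \<open>A\<close> to an admissible cover of
  the image with the same diameters, and empty pieces stay empty.\<close>

lemma hausdorff_outer_isometry_image_le: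
  fixes f :: "'a::metric_space \<Rightarrow> 'b::metric_space"
  assumes iso: "\<And>x y. dist (f x) (f y) = dist x y"
  shows "hausdorff_outer s (f ` A) \<le> hausdorff_outer s A"
proof -
  have "hausdorff_pre s \<delta> (f ` A) \<le> hausdorff_pre s \<delta> A" for \<delta>
    unfolding hausdorff_pre_def
  proof (rule INF_mono)
    fix U :: "nat \<Rightarrow> 'a set"
    assume U: "U \<in> {U. A \<subseteq> (\<Union>i. U i) \<and> (\<forall>i. bounded (U i) \<and> diameter (U i) \<le> \<delta>)}"
    have "bounded (f ` U i)" for i
      using U iso unfolding bounded_def by (auto simp: iso) (metis iso)
    then have "(\<lambda>i. f ` U i) \<in> {U. f ` A \<subseteq> (\<Union>i. U i) \<and> (\<forall>i. bounded (U i) \<and> diameter (U i) \<le> \<delta>)}"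
      using U by (simp add: diameter_isometry_image[OF iso] flip: image_UN) (metis image_mono)
    then show "\<exists>V\<in>{U. f ` A \<subseteq> (\<Union>i. U i) \<and> (\<forall>i. bounded (U i) \<and> diameter (U i) \<le> \<delta>)}.
       (\<Sum>i. if V i = {} then 0 else ennreal (diameter (V i) ^ s))
        \<le> (\<Sum>i. if U i = {} then 0 else ennreal (diameter (U i) ^ s))"
      by (rule bexI[rotated]) (simp add: diameter_isometry_image[of f, OF iso] cong: if_cong)
  qed
  then show ?thesis
    unfolding hausdorff_outer_def by (intro mult_left_mono SUP_mono') auto
qed

lemma hausdorff_outer_isometry_vimage:
  fixes f :: "'a::metric_space \<Rightarrow> 'b::metric_space"
  assumes iso: "\<And>x y. dist (f x) (f y) = dist x y" and "surj f"
  shows "hausdorff_outer s (f -` A) = hausdorff_outer s A"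
proof (rule antisym)
  have *: "f (inv f y) = y" for y
    using \<open>surj f\<close> by (simp add: surj_f_inv_f)
  have "inj f"
    by (rule injI) (metis iso dist_eq_0_iff)
  have "dist (inv f x) (inv f y) = dist x y" for x y
    using iso[of "inv f x" "inv f y"] by (simp add: *)
  from hausdorff_outer_isometry_image_le[OF this, of s A]
  show "hausdorff_outer s (f -` A) \<le> hausdorff_outer s A"
    using \<open>inj f\<close> \<open>surj f\<close> by (simp add: bij_vimage_eq_inv_image bij_def)
  from hausdorff_outer_isometry_image_le[OF iso, of s "f -` A"]
  show "hausdorff_outer s A \<le> hausdorff_outer s (f -` A)"
    using \<open>surj f\<close> by (simp add: surj_image_vimage_eq)
qed

lemma sets_hausdorff_measure [simp, measurable_cong]: "sets (hausdorff_measure s) = sets borel"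
  unfolding hausdorff_measure_def by (simp add: sets_measure_of_conv sets.sigma_sets_eq[of borel, simplified])

lemma space_hausdorff_measure [simp]: "space (hausdorff_measure s) = UNIV"
  using sets_eq_imp_space_eq[OF sets_hausdorff_measure] by simp

lemma emeasure_hausdorff_measure_vimage:
  fixes f :: "'a::metric_space \<Rightarrow> 'a"
  assumes iso: "\<And>x y. dist (f x) (f y) = dist x y" and "surj f" and A: "A \<in> sets borel"
  shows "emeasure (hausdorff_measure s) (f -` A) = emeasure (hausdorff_measure s) A"
proof -
  have "continuous_on UNIV f"
    unfolding continuous_on_iff using iso by metis
  then have "f -` A \<in> sets borel"
    using measurable_sets[OF borel_measurable_continuous_onI A] by simp
  then show ?thesis
    \<comment> \<open>The value is the outer measure if that is a measure on the Borel sets, and 0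
      otherwise; both alternatives are invariant.\<close>
    unfolding hausdorff_measure_def emeasure_measure_of_conv
    using A by (simp add: hausdorff_outer_isometry_vimage[OF iso \<open>surj f\<close>])
qed

lemma triangles_borel [measurable]: "triangles \<in> sets borel"
proof -
  have "closed {x :: (real^'n) \<times> (real^'n). norm (fst x) = 1 \<and> norm (snd x) = 1 \<and> norm (fst x - snd x) = 1}"
    by (intro closed_Collect_conj closed_Collect_eq continuous_intros)
  also have "{x :: (real^'n) \<times> (real^'n). norm (fst x) = 1 \<and> norm (snd x) = 1 \<and> norm (fst x - snd x) = 1} = triangles"
    by (auto simp: triangles_def)
  finally show ?thesis by (rule borel_closed)
qed

lemma sets_triangle_measure [simp, measurable_cong]: "sets triangle_measure = sets borel"
  by (simp add: triangle_measure_def)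

lemma space_triangle_measure [simp]: "space triangle_measure = UNIV"
  by (simp add: triangle_measure_def)

lemma emeasure_triangle_measure:
  fixes A :: "((real^'n) \<times> (real^'n)) set"
  assumes "A \<in> sets borel"
  shows "emeasure triangle_measure A = emeasure (hausdorff_measure (2 * CARD('n) - 3)) (triangles \<inter> A)
     / emeasure (hausdorff_measure (2 * CARD('n) - 3)) (triangles :: ((real^'n) \<times> (real^'n)) set)"
  using assms unfolding triangle_measure_def by (subst emeasure_uniform_measure) auto

lemma emeasure_triangle_measure_le_1:
  fixes A :: "((real^'n) \<times> (real^'n)) set"
  shows "emeasure triangle_measure A \<le> 1"
proof -
  have "emeasure triangle_measure A \<le> emeasure triangle_measure (UNIV :: ((real^'n) \<times> (real^'n)) set)"
    using emeasure_space[of triangle_measure A] by simp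
  also have "\<dots> \<le> 1"
  proof -
    \<comment> \<open>In \<open>ennreal\<close> both 0 / 0 and \<top> / \<top> are 0, which covers a
      manifold of measure 0 or infinity.\<close>
    have "x / x \<le> 1" for x :: ennreal
      by (cases "x = 0 \<or> x = \<top>") (auto simp: ennreal_divide_self less_top)
    then show ?thesis
      by (subst emeasure_triangle_measure) auto
  qed
  finally show ?thesis .
qed

lemma finite_measure_triangle_measure: "finite_measure (triangle_measure :: ((real^'n) \<times> (real^'n)) measure)"
  using emeasure_triangle_measure_le_1[of "UNIV :: ((real^'n) \<times> (real^'n)) set"]
  by (intro finite_measureI) (auto simp: top_unique)

lemma AE_triangle_measure: "AE x in triangle_measure. x \<in> triangles"
  unfolding triangle_measure_def by (rule AE_uniform_measureI) auto

lemma distr_triangle_measure: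
  fixes f :: "(real^'n) \<times> (real^'n) \<Rightarrow> (real^'n) \<times> (real^'n)"
  assumes iso: "\<And>x y. dist (f x) (f y) = dist x y" and "surj f"
    and tri: "\<And>x. f x \<in> triangles \<longleftrightarrow> x \<in> triangles"
  shows "distr triangle_measure borel f = triangle_measure"
proof (rule measure_eqI)
  fix A assume "A \<in> sets (distr triangle_measure borel f)"
  then have A: "A \<in> sets borel" by simp
  have "continuous_on UNIV f"
    unfolding continuous_on_iff using iso by metis
  then have f[measurable]: "f \<in> borel_measurable borel"
    by (rule borel_measurable_continuous_onI)
  have "f -` A \<in> sets borel"
    using measurable_sets[OF f A] by simp
  moreover have "triangles \<inter> f -` A = f -` (triangles \<inter> A)"
    using tri by (simp add: set_eq_iff del: split_paired_All)
  ultimately show "emeasure (distr triangle_measure borel f) A = emeasure triangle_measure A"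
    using A by (simp add: emeasure_distr emeasure_triangle_measure del: vimage_Int add:
        emeasure_hausdorff_measure_vimage[OF iso \<open>surj f\<close>])
qed simp

lemma distr_triangle_measure_orthogonal:
  fixes g :: "real^'n \<Rightarrow> real^'n"
  assumes g: "orthogonal_transformation g"
  shows "distr triangle_measure borel (\<lambda>x. (g (fst x), g (snd x))) = triangle_measure"
proof (rule distr_triangle_measure)
  have "dist (g x) (g y) = dist x y" for x y
    using g by (simp add: orthogonal_transformation_isometry)
  then show "dist (g (fst x), g (snd x)) (g (fst y), g (snd y)) = dist x y" for x y
    by (simp add: dist_prod_def)
  show "surj (\<lambda>x. (g (fst x), g (snd x)))"
    using orthogonal_transformation_surj[OF g] by (simp add: surj_def)
  have "norm (g a - g b) = norm (a - b)" for a b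
    using g by (metis linear_diff orthogonal_transformation_def orthogonal_transformation_norm)
  then show "(g (fst x), g (snd x)) \<in> triangles \<longleftrightarrow> x \<in> triangles" for x
    using g by (auto simp: triangles_def orthogonal_transformation_norm split: prod.splits)
qed

lemma distr_triangle_measure_swap:
  "distr triangle_measure borel prod.swap = triangle_measure"
  by (rule distr_triangle_measure)
    (auto simp: dist_prod_def triangles_def norm_minus_commute add.commute)

section \<open>Differentiation under the integral sign and reflections\<close>

lemma has_vector_derivative_iff_tendsto:
  fixes f :: "real \<Rightarrow> 'b::real_normed_vector"
  shows "(f has_vector_derivative D) (at t) \<longleftrightarrow> ((\<lambda>h. (f (t + h) - f t) /\<^sub>R h) \<longlongrightarrow> D) (at 0)"
proof -
  have "norm (f (t + h) - f t - h *\<^sub>R D) / norm h = norm ((f (t + h) - f t) /\<^sub>R h - D)" if "h \<noteq> 0" for h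
  proof -
    have "(f (t + h) - f t) /\<^sub>R h - D = (f (t + h) - f t - h *\<^sub>R D) /\<^sub>R h"
      using that by (simp add: scaleR_diff_right)
    then show ?thesis
      by (simp add: divide_inverse_commute)
  qed
  then have "((\<lambda>h. norm (f (t + h) - f t - h *\<^sub>R D) / norm h) \<longlongrightarrow> 0) (at 0) \<longleftrightarrow>
      ((\<lambda>h. norm ((f (t + h) - f t) /\<^sub>R h - D)) \<longlongrightarrow> 0) (at 0)"
    by (intro tendsto_cong eventually_at_filter[THEN iffD2] always_eventually) auto
  then show ?thesis
    unfolding has_vector_derivative_def has_derivative_at
    by (simp add: bounded_linear_scaleR_left tendsto_norm_zero_iff Lim_null[of _ D])
qed

text \<open>Dominated convergence along sequences tending to 0: by the mean value inequality the
  bound \<open>w\<close> on the derivative also dominates the difference quotients. The pointwise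
  hypotheses are almost-everywhere statements because the sample points are unit vectors only almost
  everywhere.\<close>

lemma has_vector_derivative_integral:
  fixes f f' :: "real \<Rightarrow> 'a \<Rightarrow> 'b::{banach, second_countable_topology}"
  assumes int: "\<And>s. integrable M (f s)"
    and deriv: "AE x in M. \<forall>s. ((\<lambda>s. f s x) has_vector_derivative f' s x) (at s)"
    and bound: "AE x in M. \<forall>s. norm (f' s x) \<le> w x"
    and w: "integrable M w"
    and meas: "f' t \<in> borel_measurable M"
  shows "((\<lambda>s. \<integral>x. f s x \<partial>M) has_vector_derivative (\<integral>x. f' t x \<partial>M)) (at t)"
  unfolding has_vector_derivative_iff_tendsto tendsto_at_iff_sequentially comp_def
proof (intro allI impI)
  fix h :: "nat \<Rightarrow> real"
  assume "\<forall>i. h i \<in> UNIV - {0}" and lim: "h \<longlonglongrightarrow> 0"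
  then have h0: "h i \<noteq> 0" for i by auto
  have eq: "((\<integral>x. f (t + h i) x \<partial>M) - (\<integral>x. f t x \<partial>M)) /\<^sub>R h i = (\<integral>x. (f (t + h i) x - f t x) /\<^sub>R h i \<partial>M)" for i
    using int by simp
  have "(\<lambda>i. \<integral>x. (f (t + h i) x - f t x) /\<^sub>R h i \<partial>M) \<longlonglongrightarrow> (\<integral>x. f' t x \<partial>M)"
  proof (rule integral_dominated_convergence[where w=w])
    show "f' t \<in> borel_measurable M" "integrable M w" by fact+
    show "(\<lambda>x. (f (t + h i) x - f t x) /\<^sub>R h i) \<in> borel_measurable M" for i
      using int by (intro borel_measurable_scaleR borel_measurable_diff) auto
    show "AE x in M. (\<lambda>i. (f (t + h i) x - f t x) /\<^sub>R h i) \<longlonglongrightarrow> f' t x"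
      using deriv
    proof eventually_elim
      case (elim x)
      then have "((\<lambda>h. (f (t + h) x - f t x) /\<^sub>R h) \<longlongrightarrow> f' t x) (at 0)"
        by (auto simp: has_vector_derivative_iff_tendsto)
      then show ?case
        using h0 lim by (auto simp: tendsto_at_iff_sequentially comp_def)
    qed
    show "AE x in M. norm ((f (t + h i) x - f t x) /\<^sub>R h i) \<le> w x" for i
      using deriv bound
    proof eventually_elim
      case (elim x)
      have "norm (f (t + h i) x - f t x) \<le> w x * norm (t + h i - t)"
      proof (rule differentiable_bound[of UNIV _ "\<lambda>s k. k *\<^sub>R f' s x"])
        show "((\<lambda>s. f s x) has_derivative (\<lambda>k. k *\<^sub>R f' s x)) (at s)" for s
          using elim by (auto simp: has_vector_derivative_def)
        show "onorm (\<lambda>k::real. k *\<^sub>R f' s x) \<le> w x" for s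
          using elim by (intro onorm_le) (auto simp: mult.commute intro: mult_left_mono)
      qed auto
      then show ?case
        using h0[of i] unfolding norm_scaleR by (simp add: abs_inverse divide_simps)
    qed
  qed
  then show "(\<lambda>i. ((\<integral>x. f (t + h i) x \<partial>M) - (\<integral>x. f t x \<partial>M)) /\<^sub>R h i) \<longlonglongrightarrow> (\<integral>x. f' t x \<partial>M)"
    unfolding eq .
qed

section \<open>Reflections and orthonormal completions\<close>

lemma reflection_exists:
  fixes p q :: "'a::euclidean_space"
  assumes "norm p = norm q"
  obtains g where "orthogonal_transformation g" "g p = q" "\<And>x. x \<bullet> p = x \<bullet> q \<Longrightarrow> g x = x"
proof (cases "p = q")
  case True
  then show ?thesis by (intro that[of "\<lambda>x. x"]) auto
next
  case False
  define a where "a = p - q"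
  define g where "g x = x - (2 * (x \<bullet> a) / (a \<bullet> a)) *\<^sub>R a" for x
  have a: "a \<bullet> a > 0"
    using False by (simp add: a_def)
  have pq: "p \<bullet> p = q \<bullet> q"
    using assms by (simp add: norm_eq_sqrt_inner)
  show ?thesis
  proof
    have "linear g"
      unfolding g_def by (intro linearI) (auto simp: algebra_simps inner_simps add_divide_distrib)
    moreover have "g v \<bullet> g w = v \<bullet> w" for v w
      using a by (simp add: g_def inner_simps inner_commute field_simps)
    ultimately show "orthogonal_transformation g"
      by (simp add: orthogonal_transformation_def)
    have "2 * (p \<bullet> a) = a \<bullet> a"
      using pq by (simp add: a_def inner_simps inner_commute)
    then show "g p = q"
      using a by (simp add: g_def) (simp add: a_def)
    show "g x = x" if "x \<bullet> p = x \<bullet> q" for x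
      using that by (simp add: g_def a_def inner_simps)
  qed
qed

text \<open>In the plane of \<open>e\<close> and \<open>f\<close> this is the reflection in the line
  at angle \<theta>/2 to \<open>e\<close>, that is, the rotation by \<theta> after the fixed
  reflection \<open>f\<close> to \<open>- f\<close>. It serves as the one-parameter family of
  rotations, with the advantage that a single hyperplane reflection along \<open>a\<close> describes
  it.\<close>

lemma plane_reflection_exists:
  fixes e f :: "'a::euclidean_space"
  assumes "norm e = 1" "norm f = 1" "e \<bullet> f = 0"
  obtains g where "orthogonal_transformation g"
    "\<And>x. g x \<bullet> e = cos \<theta> * (x \<bullet> e) + sin \<theta> * (x \<bullet> f)"
    "\<And>x. g x \<bullet> f = sin \<theta> * (x \<bullet> e) - cos \<theta> * (x \<bullet> f)"
    "\<And>n. n \<bullet> e = 0 \<Longrightarrow> n \<bullet> f = 0 \<Longrightarrow> g n = n"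
proof
  have ee: "e \<bullet> e = 1" "f \<bullet> f = 1" "f \<bullet> e = 0" "e \<bullet> f = 0"
    using assms by (simp_all add: norm_eq_1 inner_commute)
  define a where "a = sin (\<theta>/2) *\<^sub>R e - cos (\<theta>/2) *\<^sub>R f"
  define g where "g x = x - (2 * (x \<bullet> a)) *\<^sub>R a" for x
  have a: "a \<bullet> a = 1" "e \<bullet> a = sin (\<theta>/2)" "f \<bullet> a = - cos (\<theta>/2)"
    by (simp_all add: a_def inner_simps ee flip: power2_eq_square)
  have c: "cos \<theta> = 1 - 2 * (sin (\<theta>/2))\<^sup>2" "cos \<theta> = 2 * (cos (\<theta>/2))\<^sup>2 - 1" "sin \<theta> = 2 * sin (\<theta>/2) * cos (\<theta>/2)"
    using cos_double_sin[of "\<theta>/2"] cos_double_cos[of "\<theta>/2"] sin_double[of "\<theta>/2"] by simp_all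
  have "linear g"
    unfolding g_def by (intro linearI) (auto simp: algebra_simps inner_simps)
  moreover have "g v \<bullet> g w = v \<bullet> w" for v w
    using a by (simp add: g_def inner_simps inner_commute field_simps)
  ultimately show "orthogonal_transformation g"
    by (simp add: orthogonal_transformation_def)
  show "g x \<bullet> e = cos \<theta> * (x \<bullet> e) + sin \<theta> * (x \<bullet> f)" for x
    unfolding c(1,3) by (simp add: g_def inner_simps a inner_commute[of a]) (simp add: a_def inner_simps algebra_simps power2_eq_square)
  show "g x \<bullet> f = sin \<theta> * (x \<bullet> e) - cos \<theta> * (x \<bullet> f)" for x
    unfolding c(2,3) by (simp add: g_def inner_simps a inner_commute[of a]) (simp add: a_def inner_simps algebra_simps power2_eq_square)
  show "g n = n" if "n \<bullet> e = 0" "n \<bullet> f = 0" for n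
    using that by (simp add: g_def a_def inner_simps)
qed

lemma sum_inner_orthogonal_transformation_Basis:
  fixes g :: "'a::euclidean_space \<Rightarrow> 'a" and x :: "'a::euclidean_space"
  assumes g: "orthogonal_transformation g"
  shows "(\<Sum>b\<in>Basis. (x \<bullet> g b)\<^sup>2) = (norm x)\<^sup>2"
proof -
  obtain y where y: "g y = x"
    using orthogonal_transformation_surj[OF g] by (metis surjD)
  have "(\<Sum>b\<in>Basis. (x \<bullet> g b)\<^sup>2) = (\<Sum>b\<in>Basis. (y \<bullet> b)\<^sup>2)"
    using g by (simp add: orthogonal_transformation_def flip: y)
  also have "\<dots> = (norm y)\<^sup>2"
    by (simp add: norm_eq_sqrt_inner euclidean_inner[of y y] power2_eq_square sum_nonneg)
  also have "\<dots> = (norm x)\<^sup>2"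
    using orthogonal_transformation_norm[OF g, of y] y by simp
  finally show ?thesis .
qed

lemma unit_vector_completion:
  fixes e :: "'a::euclidean_space"
  assumes "norm e = 1"
  obtains B where "finite B" "card B = DIM('a) - 1" "\<And>b. b \<in> B \<Longrightarrow> norm b = 1" "\<And>b. b \<in> B \<Longrightarrow> e \<bullet> b = 0"
    "\<And>x. (norm x)\<^sup>2 = (x \<bullet> e)\<^sup>2 + (\<Sum>b\<in>B. (x \<bullet> b)\<^sup>2)"
proof -
  obtain b0 :: 'a where b0: "b0 \<in> Basis"
    using nonempty_Basis by blast
  obtain g where g: "orthogonal_transformation g" "g b0 = e"
    using reflection_exists[of b0 e] b0 assms by (metis norm_Basis)
  have inj: "inj g"
    using g by (simp add: orthogonal_transformation_inj)
  show ?thesis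
  proof
    show "card (g ` (Basis - {b0})) = DIM('a) - 1"
      using b0 inj by (subst card_image) (auto intro: inj_on_subset)
    show "norm b = 1" if "b \<in> g ` (Basis - {b0})" for b
      using that g by (auto simp: orthogonal_transformation_norm)
    show "e \<bullet> b = 0" if "b \<in> g ` (Basis - {b0})" for b
      using that g b0 by (auto simp: orthogonal_transformation_def inner_Basis split: if_splits simp flip: g(2))
    show "(norm x)\<^sup>2 = (x \<bullet> e)\<^sup>2 + (\<Sum>b\<in>g ` (Basis - {b0}). (x \<bullet> b)\<^sup>2)" for x
      using sum_inner_orthogonal_transformation_Basis[OF g(1), of x] b0
      by (subst sum.reindex) (auto intro: inj_on_subset[OF inj] simp: sum.remove[of _ b0] g(2))
  qed auto
qed

lemma orthonormal_pair_completion: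
  fixes n e :: "'a::euclidean_space"
  assumes "norm n = 1" "norm e = 1" "n \<bullet> e = 0"
  obtains B where "finite B" "card B = DIM('a) - 2" "\<And>b. b \<in> B \<Longrightarrow> norm b = 1"
    "\<And>b. b \<in> B \<Longrightarrow> n \<bullet> b = 0" "\<And>b. b \<in> B \<Longrightarrow> e \<bullet> b = 0"
    "\<And>x. (norm x)\<^sup>2 = (x \<bullet> n)\<^sup>2 + (x \<bullet> e)\<^sup>2 + (\<Sum>b\<in>B. (x \<bullet> b)\<^sup>2)"
proof -
  obtain b0 :: 'a where b0: "b0 \<in> Basis"
    using nonempty_Basis by blast
  obtain g1 where g1: "orthogonal_transformation g1" "g1 b0 = n"
    using reflection_exists[of b0 n] b0 assms by (metis norm_Basis)
  \<comment> \<open>A second basis vector exists, since in dimension one no unit vector is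
    orthogonal to \<open>n\<close>.\<close>
  have "\<not> Basis \<subseteq> {b0}"
  proof
    assume "Basis \<subseteq> {b0}"
    then have Basis: "(Basis :: 'a set) = {b0}"
      using b0 by auto
    have "(norm e)\<^sup>2 = (e \<bullet> n)\<^sup>2"
      using sum_inner_orthogonal_transformation_Basis[OF g1(1), of e] unfolding Basis g1(2)[symmetric] by simp
    then show False
      using assms by (simp add: inner_commute)
  qed
  then obtain b1 where b1: "b1 \<in> Basis" "b1 \<noteq> b0"
    by auto
  \<comment> \<open>Both sides vanish. This is the condition under which the reflection taking
    \<open>g1 b1\<close> to \<open>e\<close> fixes \<open>n\<close>.\<close>
  have "n \<bullet> g1 b1 = n \<bullet> e"
    using g1 b0 b1 assms(3) by (simp add: orthogonal_transformation_def inner_Basis flip: g1(2))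
  then obtain g2 where g2: "orthogonal_transformation g2" "g2 (g1 b1) = e" "g2 n = n"
    using reflection_exists[of "g1 b1" e] b1 assms g1 by (metis norm_Basis orthogonal_transformation_norm)
  define g where "g = g2 \<circ> g1"
  have g: "orthogonal_transformation g" "g b0 = n" "g b1 = e"
    using g1 g2 by (auto simp: g_def intro: orthogonal_transformation_compose)
  have inj: "inj g"
    using g by (simp add: orthogonal_transformation_inj)
  show ?thesis
  proof
    show "card (g ` (Basis - {b0, b1})) = DIM('a) - 2"
      using b0 b1 inj by (subst card_image) (auto intro: inj_on_subset simp: card_Diff_subset)
    show "norm b = 1" if "b \<in> g ` (Basis - {b0, b1})" for b
      using that g by (auto simp: orthogonal_transformation_norm)
    show "n \<bullet> b = 0" if "b \<in> g ` (Basis - {b0, b1})" for b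
      using that g b0 by (auto simp: orthogonal_transformation_def inner_Basis split: if_splits simp flip: g(2))
    show "e \<bullet> b = 0" if "b \<in> g ` (Basis - {b0, b1})" for b
      using that g b1 by (auto simp: orthogonal_transformation_def inner_Basis split: if_splits simp flip: g(3))
    have "Basis = insert b0 (insert b1 (Basis - {b0, b1}))"
      using b0 b1 by auto
    then have "(\<Sum>b\<in>Basis. (x \<bullet> g b)\<^sup>2) = (x \<bullet> g b0)\<^sup>2 + ((x \<bullet> g b1)\<^sup>2 + (\<Sum>b\<in>Basis - {b0, b1}. (x \<bullet> g b)\<^sup>2))" for x
      using b1 by (subst \<open>Basis = _\<close>) (subst sum.insert; simp)+
    then show "(norm x)\<^sup>2 = (x \<bullet> n)\<^sup>2 + (x \<bullet> e)\<^sup>2 + (\<Sum>b\<in>g ` (Basis - {b0, b1}). (x \<bullet> b)\<^sup>2)" for x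
      using sum_inner_orthogonal_transformation_Basis[OF g(1), of x]
      by (subst sum.reindex) (auto intro: inj_on_subset[OF inj] simp: g)
  qed auto
qed

lemma abs_inner_le_1:
  fixes x y :: "'a::real_inner"
  assumes "norm x = 1" "norm y = 1"
  shows "\<bar>x \<bullet> y\<bar> \<le> 1"
  using Cauchy_Schwarz_ineq2[of x y] assms by simp

text \<open>Integration by parts on the sphere. Turning \<open>w\<close> by the angle s in the plane
  of \<open>e\<close> and \<open>f\<close> gives coordinates X and Y with X' = - Y and Y' = X. By
  invariance the mean of Y * h X does not depend on s, and its derivative at s = 0 is the claim. The
  vector \<open>n\<close> allows for measures invariant only under the stabilizer of a
  direction.\<close>

lemma rotation_identity:
  fixes w :: "'z \<Rightarrow> 'a::euclidean_space" and h h' :: "real \<Rightarrow> real"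
  assumes "finite_measure M" and w[measurable]: "w \<in> borel_measurable M"
    and unit: "AE z in M. norm (w z) = 1"
    and inv: "\<And>g. orthogonal_transformation g \<Longrightarrow> g n = n \<Longrightarrow>
      distr M borel (\<lambda>z. g (w z)) = distr M borel w"
    and ef: "norm e = 1" "norm f = 1" "e \<bullet> f = 0" "n \<bullet> e = 0" "n \<bullet> f = 0"
    and h: "\<And>t. \<bar>t\<bar> \<le> 1 \<Longrightarrow> (h has_real_derivative h' t) (at t)"
    and [measurable]: "h \<in> borel_measurable borel" "h' \<in> borel_measurable borel"
    and K: "\<And>t. \<bar>t\<bar> \<le> 1 \<Longrightarrow> \<bar>h t\<bar> \<le> K" "\<And>t. \<bar>t\<bar> \<le> 1 \<Longrightarrow> \<bar>h' t\<bar> \<le> K"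
  shows "(\<integral>z. (w z \<bullet> e) * h (w z \<bullet> e) - (w z \<bullet> f)\<^sup>2 * h' (w z \<bullet> e) \<partial>M) = 0"
proof -
  interpret finite_measure M by fact
  define X where "X s z = cos s * (w z \<bullet> e) + sin s * (w z \<bullet> f)" for s z
  define Y where "Y s z = sin s * (w z \<bullet> e) - cos s * (w z \<bullet> f)" for s z
  have [measurable]: "X s \<in> borel_measurable M" "Y s \<in> borel_measurable M" for s
    unfolding X_def Y_def by measurable
  have XY: "\<bar>X s z\<bar> \<le> 1 \<and> \<bar>Y s z\<bar> \<le> 1" if "norm (w z) = 1" for s z
  proof -
    obtain g where g: "orthogonal_transformation g"
      "\<And>x. g x \<bullet> e = cos s * (x \<bullet> e) + sin s * (x \<bullet> f)"
      "\<And>x. g x \<bullet> f = sin s * (x \<bullet> e) - cos s * (x \<bullet> f)"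
      using plane_reflection_exists[OF ef(1-3), of s] by metis
    have "X s z = g (w z) \<bullet> e" "Y s z = g (w z) \<bullet> f"
      by (simp_all add: g X_def Y_def)
    then show ?thesis
      using g(1) that ef by (simp add: abs_inner_le_1 orthogonal_transformation_norm)
  qed
  have const: "(\<integral>z. Y s z * h (X s z) \<partial>M) = (\<integral>z. (w z \<bullet> f) * h (w z \<bullet> e) \<partial>M)" for s
  proof -
    obtain g where g: "orthogonal_transformation g"
      "\<And>x. g x \<bullet> e = cos s * (x \<bullet> e) + sin s * (x \<bullet> f)"
      "\<And>x. g x \<bullet> f = sin s * (x \<bullet> e) - cos s * (x \<bullet> f)"
      "\<And>n. n \<bullet> e = 0 \<Longrightarrow> n \<bullet> f = 0 \<Longrightarrow> g n = n"
      using plane_reflection_exists[OF ef(1-3), of s] by metis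
    have [measurable]: "g \<in> borel_measurable borel"
      using g(1) by (intro borel_measurable_continuous_onI linear_continuous_on)
        (simp add: linear_linear orthogonal_transformation_linear)
    have "(\<integral>z. Y s z * h (X s z) \<partial>M) = (\<integral>x. (x \<bullet> f) * h (x \<bullet> e) \<partial>distr M borel (\<lambda>z. g (w z)))"
      by (subst integral_distr) (auto simp: X_def Y_def g)
    also have "distr M borel (\<lambda>z. g (w z)) = distr M borel w"
      using g ef by (intro inv) auto
    also have "(\<integral>x. (x \<bullet> f) * h (x \<bullet> e) \<partial>distr M borel w) = (\<integral>z. (w z \<bullet> f) * h (w z \<bullet> e) \<partial>M)"
      by (subst integral_distr) auto
    finally show ?thesis .
  qed
  have K0: "K \<ge> 0"
    using K(1)[of 0] by simp
  have "((\<lambda>s. \<integral>z. Y s z * h (X s z) \<partial>M) has_vector_derivative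
      (\<integral>z. X 0 z * h (X 0 z) - (Y 0 z)\<^sup>2 * h' (X 0 z) \<partial>M)) (at 0)"
  proof (rule has_vector_derivative_integral[where w="\<lambda>_. 2 * K" and f'="\<lambda>s z. X s z * h (X s z) - (Y s z)\<^sup>2 * h' (X s z)"])
    show "integrable M (\<lambda>z. Y s z * h (X s z))" for s
    proof (rule integrable_const_bound[where B=K])
      show "AE z in M. norm (Y s z * h (X s z)) \<le> K"
        using unit
      proof eventually_elim
        case (elim z)
        show ?case
          using mult_mono[of "\<bar>Y s z\<bar>" 1 "\<bar>h (X s z)\<bar>" K] XY[OF elim, of s] K(1)[of "X s z"] by (simp add: abs_mult)
      qed
    qed measurable
    show "AE z in M. \<forall>s. ((\<lambda>s. Y s z * h (X s z)) has_vector_derivative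
        X s z * h (X s z) - (Y s z)\<^sup>2 * h' (X s z)) (at s)"
      using unit
    proof eventually_elim
      case (elim z)
      have "((\<lambda>s. Y s z * h (X s z)) has_real_derivative X s z * h (X s z) - (Y s z)\<^sup>2 * h' (X s z)) (at s)" for s
      proof -
        have X: "((\<lambda>s. X s z) has_real_derivative - Y s z) (at s)"
          unfolding X_def Y_def by (auto intro!: derivative_eq_intros)
        have Y: "((\<lambda>s. Y s z) has_real_derivative X s z) (at s)"
          unfolding X_def Y_def by (auto intro!: derivative_eq_intros)
        have "((\<lambda>s. h (X s z)) has_real_derivative h' (X s z) * - Y s z) (at s)"
          using XY[OF elim, of s] by (intro DERIV_chain2[OF h X]) auto
        from DERIV_mult[OF Y this] show ?thesis
          by (simp add: power2_eq_square algebra_simps)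
      qed
      then show ?case
        by (simp add: has_real_derivative_iff_has_vector_derivative)
    qed
    show "AE z in M. \<forall>s. norm (X s z * h (X s z) - (Y s z)\<^sup>2 * h' (X s z)) \<le> 2 * K"
      using unit
    proof eventually_elim
      case (elim z)
      have "\<bar>X s z * h (X s z) - (Y s z)\<^sup>2 * h' (X s z)\<bar> \<le> 2 * K" for s
      proof -
        have "\<bar>X s z * h (X s z)\<bar> \<le> 1 * K"
          unfolding abs_mult using XY[OF elim, of s] K0 K(1)[of "X s z"] by (intro mult_mono) auto
        moreover have "\<bar>(Y s z)\<^sup>2 * h' (X s z)\<bar> \<le> 1 * K"
          unfolding abs_mult using XY[OF elim, of s] K0 K(2)[of "X s z"]
          by (intro mult_mono) (auto simp: abs_square_le_1)
        ultimately show ?thesis by linarith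
      qed
      then show ?case by simp
    qed
    show "(\<lambda>z. X 0 z * h (X 0 z) - (Y 0 z)\<^sup>2 * h' (X 0 z)) \<in> borel_measurable M"
      by measurable
  qed auto
  then have "((\<lambda>s::real. \<integral>z. (w z \<bullet> f) * h (w z \<bullet> e) \<partial>M) has_vector_derivative
      (\<integral>z. X 0 z * h (X 0 z) - (Y 0 z)\<^sup>2 * h' (X 0 z) \<partial>M)) (at 0)"
    unfolding const .
  from vector_derivative_unique_at[OF this has_vector_derivative_const]
  show ?thesis by (simp add: X_def Y_def)
qed

section \<open>Measures on the sphere invariant under the orthogonal group\<close>

text \<open>Write t = z \<bullet> e and s = 1 - t^2. \<open>rotation_identity\<close> for h t = t *
  k t, summed over an orthonormal basis of the hyperplane orthogonal to \<open>e\<close>, shows that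
  (d - 1) t^2 k - s (k + t k') has mean 0. Since s t k' <= 2 N t^2 k and d - 1 = 2 N + 1, the
  integrand is at least t^2 k - s k = k - 2 s k, and s k stays under control at the poles, where k
  is large. The term \<epsilon> keeps the integrands bounded; the final bound is uniform in
  it.\<close>

lemma sphere_negative_moment:
  fixes M :: "'a::euclidean_space measure" and e :: 'a and \<epsilon> :: real
  defines "N \<equiv> (real DIM('a) - 2) / 2"
  assumes fin: "finite_measure M" and sets[measurable_cong, simp]: "sets M = sets borel"
    and unit: "AE z in M. norm z = 1"
    and inv: "\<And>g. orthogonal_transformation g \<Longrightarrow> distr M borel g = M"
    and dim: "DIM('a) \<ge> 2" and e: "norm e = 1" and \<epsilon>: "\<epsilon> > 0"
  shows "integrable M (\<lambda>z. (1 - (z \<bullet> e)\<^sup>2 + \<epsilon>) powr (- N))" (is ?int)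
    and "(\<integral>z. (1 - (z \<bullet> e)\<^sup>2 + \<epsilon>) powr (- N) \<partial>M) \<le> 4 * 4 powr N * measure M UNIV" (is ?le)
proof -
  interpret finite_measure M by fact
  have space[simp]: "space M = UNIV"
    using sets_eq_imp_space_eq[OF sets] by simp
  have N0: "N \<ge> 0"
    using dim by (simp add: N_def)
  define k where "k t = (1 - t\<^sup>2 + \<epsilon>) powr (- N)" for t
  define k' where "k' t = 2 * N * t * (1 - t\<^sup>2 + \<epsilon>) powr (- N - 1)" for t
  have [measurable]: "k \<in> borel_measurable borel" "k' \<in> borel_measurable borel"
    unfolding k_def k'_def by measurable
  have pos: "1 - t\<^sup>2 + \<epsilon> \<ge> \<epsilon>" "1 - t\<^sup>2 + \<epsilon> > 0" if "\<bar>t\<bar> \<le> 1" for t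
    using that \<epsilon> abs_square_le_1[of t] by auto
  have k_le: "0 \<le> k t" "k t \<le> \<epsilon> powr (- N)" "\<bar>k t\<bar> \<le> \<epsilon> powr (- N)" if "\<bar>t\<bar> \<le> 1" for t
    using pos[OF that] \<epsilon> N0 by (auto simp: k_def intro: powr_mono2')
  have k'_le: "\<bar>k' t\<bar> \<le> 2 * N * \<epsilon> powr (- N - 1)" if "\<bar>t\<bar> \<le> 1" for t
  proof -
    have "(1 - t\<^sup>2 + \<epsilon>) powr (- N - 1) \<le> \<epsilon> powr (- N - 1)"
      using pos[OF that] \<epsilon> N0 by (intro powr_mono2') auto
    then have "N * \<bar>t\<bar> * (1 - t\<^sup>2 + \<epsilon>) powr (- N - 1) \<le> N * 1 * \<epsilon> powr (- N - 1)"
      using that N0 by (intro mult_mono) auto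
    then show ?thesis
      using N0 by (simp add: k'_def abs_mult)
  qed
  define K where "K = \<epsilon> powr (- N) + 2 * N * \<epsilon> powr (- N - 1)"
  have K0: "2 * N * \<epsilon> powr (- N - 1) \<ge> 0" "\<epsilon> powr (- N) \<ge> 0"
    using N0 by auto
  have h: "((\<lambda>t. t * k t) has_real_derivative (k t + t * k' t)) (at t)" if "\<bar>t\<bar> \<le> 1" for t
    unfolding k_def k'_def using pos[OF that]
    by (auto intro!: derivative_eq_intros simp: powr_diff field_simps)
  have bounds: "\<bar>t * k t\<bar> \<le> K" "\<bar>k t + t * k' t\<bar> \<le> K" if "\<bar>t\<bar> \<le> 1" for t
  proof -
    have "\<bar>t * k t\<bar> \<le> 1 * \<epsilon> powr (- N)"
      unfolding abs_mult using that k_le[OF that] by (intro mult_mono) auto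
    then show "\<bar>t * k t\<bar> \<le> K"
      using K0 by (simp add: K_def)
    have "\<bar>t * k' t\<bar> \<le> 1 * (2 * N * \<epsilon> powr (- N - 1))"
      unfolding abs_mult using that k'_le[OF that] by (intro mult_mono) auto
    then show "\<bar>k t + t * k' t\<bar> \<le> K"
      using k_le[OF that] by (simp add: K_def)
  qed
  obtain B where B: "finite B" "card B = DIM('a) - 1" "\<And>b. b \<in> B \<Longrightarrow> norm b = 1" "\<And>b. b \<in> B \<Longrightarrow> e \<bullet> b = 0"
    "\<And>x. (norm x)\<^sup>2 = (x \<bullet> e)\<^sup>2 + (\<Sum>b\<in>B. (x \<bullet> b)\<^sup>2)"
    using unit_vector_completion[OF e] by metis
  have le1: "AE z in M. \<bar>z \<bullet> e\<bar> \<le> 1"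
    using unit by eventually_elim (use e abs_inner_le_1 in blast)
  have bounded_int: "integrable M (\<lambda>z. F z)" if [measurable]: "F \<in> borel_measurable borel"
    and "\<And>z. norm z = 1 \<Longrightarrow> \<bar>F z\<bar> \<le> C" for F :: "'a \<Rightarrow> real" and C
    by (rule integrable_const_bound[where B=C]) (use unit that in auto)
  have int1: "integrable M (\<lambda>z. (z \<bullet> e) * ((z \<bullet> e) * k (z \<bullet> e)))"
  proof (rule bounded_int)
    fix z :: 'a assume "norm z = 1"
    then have "\<bar>z \<bullet> e\<bar> \<le> 1" using e by (rule abs_inner_le_1)
    then show "\<bar>(z \<bullet> e) * ((z \<bullet> e) * k (z \<bullet> e))\<bar> \<le> 1 * K"
      using bounds(1)[of "z \<bullet> e"] unfolding abs_mult[of "z \<bullet> e"] by (intro mult_mono) auto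
  qed measurable
  have int2: "integrable M (\<lambda>z. (z \<bullet> b)\<^sup>2 * (k (z \<bullet> e) + (z \<bullet> e) * k' (z \<bullet> e)))" if "b \<in> B" for b
  proof (rule bounded_int)
    fix z :: 'a assume z: "norm z = 1"
    then have "\<bar>z \<bullet> e\<bar> \<le> 1" "\<bar>z \<bullet> b\<bar> \<le> 1" using e B(3)[OF that] by (auto intro: abs_inner_le_1)
    then show "\<bar>(z \<bullet> b)\<^sup>2 * (k (z \<bullet> e) + (z \<bullet> e) * k' (z \<bullet> e))\<bar> \<le> 1 * K"
      using bounds(2)[of "z \<bullet> e"] unfolding abs_mult[of "(z \<bullet> b)\<^sup>2"] by (intro mult_mono) (auto simp: abs_square_le_1)
  qed measurable
  have int3: "integrable M (\<lambda>z. k (z \<bullet> e))"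
    by (rule bounded_int[where C="\<epsilon> powr (- N)"]) (use k_le(3) e abs_inner_le_1 in auto)
  then show ?int by (simp add: k_def)
  have "(\<integral>z. (z \<bullet> e) * ((z \<bullet> e) * k (z \<bullet> e)) - (z \<bullet> b)\<^sup>2 * (k (z \<bullet> e) + (z \<bullet> e) * k' (z \<bullet> e)) \<partial>M) = 0"
    if "b \<in> B" for b
  \<comment> \<open>With \<open>n = 0\<close> the condition \<open>g n = n\<close> holds for every
    orthogonal \<open>g\<close>, so the full group acts.\<close>
  proof (rule rotation_identity[where w="\<lambda>z. z" and n=0 and h="\<lambda>t. t * k t" and h'="\<lambda>t. k t + t * k' t" and K=K])
    show "distr M borel (\<lambda>z. g z) = distr M borel (\<lambda>z. z)" if "orthogonal_transformation g" for g
      using inv[OF that] inv[OF orthogonal_transformation_id] by simp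
  qed (use fin unit e B(3,4) that h bounds in auto)
  then have "(\<Sum>b\<in>B. \<integral>z. (z \<bullet> e) * ((z \<bullet> e) * k (z \<bullet> e)) - (z \<bullet> b)\<^sup>2 * (k (z \<bullet> e) + (z \<bullet> e) * k' (z \<bullet> e)) \<partial>M) = 0"
    by simp
  then have "(\<integral>z. (\<Sum>b\<in>B. (z \<bullet> e) * ((z \<bullet> e) * k (z \<bullet> e)) - (z \<bullet> b)\<^sup>2 * (k (z \<bullet> e) + (z \<bullet> e) * k' (z \<bullet> e))) \<partial>M) = 0"
    using int1 int2 by (subst Bochner_Integration.integral_sum) auto
  then have zero: "(\<integral>z. real (DIM('a) - 1) * ((z \<bullet> e)\<^sup>2 * k (z \<bullet> e))
      - (\<Sum>b\<in>B. (z \<bullet> b)\<^sup>2) * (k (z \<bullet> e) + (z \<bullet> e) * k' (z \<bullet> e)) \<partial>M) = 0"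
    by (simp add: sum_subtractf B(2) sum_distrib_right power2_eq_square mult.assoc)
  have int4: "integrable M (\<lambda>z. real (DIM('a) - 1) * ((z \<bullet> e)\<^sup>2 * k (z \<bullet> e))
      - (\<Sum>b\<in>B. (z \<bullet> b)\<^sup>2) * (k (z \<bullet> e) + (z \<bullet> e) * k' (z \<bullet> e)))"
    using int1 int2 by (auto simp: sum_distrib_right power2_eq_square mult.assoc intro!: integrable_diff)
  have "AE z in M. k (z \<bullet> e) / 2 - 2 * 4 powr N
     \<le> real (DIM('a) - 1) * ((z \<bullet> e)\<^sup>2 * k (z \<bullet> e))
      - (\<Sum>b\<in>B. (z \<bullet> b)\<^sup>2) * (k (z \<bullet> e) + (z \<bullet> e) * k' (z \<bullet> e))"
    using unit le1
  proof eventually_elim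
    case (elim z)
    define t where "t = z \<bullet> e"
    have t: "\<bar>t\<bar> \<le> 1" using elim by (simp add: t_def)
    define s where "s = 1 - t\<^sup>2"
    have s: "(\<Sum>b\<in>B. (z \<bullet> b)\<^sup>2) = s"
      using B(5)[of z] elim by (simp add: t_def s_def)
    have s01: "0 \<le> s" "s \<le> 1" "t\<^sup>2 = 1 - s"
      using t by (auto simp: s_def abs_square_le_1)
    have kt: "k t = (s + \<epsilon>) powr (- N)"
      by (simp add: k_def s_def)
    have k't: "s * (t * k' t) \<le> 2 * N * (t\<^sup>2 * k t)"
    proof -
      have "(s + \<epsilon>) powr (- N - 1) * (s + \<epsilon>) = (s + \<epsilon>) powr (- N)"
        using s01 \<epsilon> powr_add[of "s + \<epsilon>" "- N - 1" 1] by simp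
      moreover have "s * (s + \<epsilon>) powr (- N - 1) \<le> (s + \<epsilon>) * (s + \<epsilon>) powr (- N - 1)"
        using \<epsilon> by (intro mult_right_mono) auto
      ultimately have "s * (s + \<epsilon>) powr (- N - 1) \<le> k t"
        by (simp add: kt mult.commute)
      then have "2 * N * t\<^sup>2 * (s * (s + \<epsilon>) powr (- N - 1)) \<le> 2 * N * t\<^sup>2 * k t"
        using N0 by (intro mult_left_mono) auto
      then show ?thesis
        by (simp add: k'_def s_def power2_eq_square algebra_simps)
    qed
    \<comment> \<open>Where \<open>k\<close> is large the factor s is small. The threshold 1/4
      leaves half of \<open>k t\<close> in k - 2 s k; above it \<open>k t\<close> is at most 4 powr
      N. This produces the constant 4 * 4 powr N.\<close>
    have sk: "s * k t \<le> k t / 4 + 4 powr N"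
    proof (cases "s \<le> 1/4")
      case True
      then have "s * k t \<le> 1 / 4 * k t"
        using k_le[OF t] by (intro mult_right_mono) auto
      moreover have "4 powr N \<ge> (0::real)" by simp
      ultimately show ?thesis by linarith
    next
      case False
      have "k t \<le> (1/4) powr (- N)"
        unfolding kt using False \<epsilon> N0 by (intro powr_mono2') auto
      also have "\<dots> = 4 powr N"
        by (simp add: powr_divide powr_minus)
      finally have "s * k t \<le> 1 * 4 powr N"
        using s01 k_le[OF t] by (intro mult_mono) auto
      then show ?thesis using k_le(1)[OF t] by simp
    qed
    have dimN: "real (DIM('a) - 1) = 2 * N + 1"
      using dim by (simp add: N_def field_simps)
    have "real (DIM('a) - 1) * (t\<^sup>2 * k t) - s * (k t + t * k' t) \<ge> t\<^sup>2 * k t - s * k t"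
      using k't unfolding dimN by (simp add: algebra_simps)
    also have "t\<^sup>2 * k t - s * k t = k t - 2 * (s * k t)"
      unfolding s01(3) by (simp add: algebra_simps)
    finally show ?case
      using sk unfolding s t_def[symmetric] by linarith
  qed
  then have "(\<integral>z. k (z \<bullet> e) / 2 - 2 * 4 powr N \<partial>M) \<le> 0"
    using int3 int4 unfolding zero[symmetric] by (intro integral_mono_AE) auto
  then show ?le
    using int3 by (simp add: k_def algebra_simps)
qed

text \<open>Almost all values of \<open>w\<close> lie on the unit sphere of the hyperplane
  orthogonal to \<open>n\<close>, which has dimension d - 2; this is the coefficient of the
  first-order term in the differential equation and twice the decay exponent N.\<close>

lemma sphere_fourier_decay:
  fixes M :: "'z measure" and w :: "'z \<Rightarrow> 'a::euclidean_space" and n e :: 'a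
  defines "N \<equiv> (real DIM('a) - 2) / 2"
  assumes fin: "finite_measure M" and w[measurable]: "w \<in> borel_measurable M"
    and unit: "AE z in M. norm (w z) = 1 \<and> w z \<bullet> n = 0"
    and inv: "\<And>g. orthogonal_transformation g \<Longrightarrow> g n = n \<Longrightarrow>
      distr M borel (\<lambda>z. g (w z)) = distr M borel w"
    and dim: "DIM('a) \<ge> 2" and n: "norm n = 1" and e: "norm e = 1" and ne: "n \<bullet> e = 0" and r: "r \<ge> 0"
  shows "\<bar>\<integral>z. cos (r * (w z \<bullet> e)) \<partial>M\<bar> \<le> 2 powr N * sqrt (((1 + N)\<^sup>2 + 1) * exp \<bar>N\<^sup>2 - N\<bar>) * measure M (space M) * (1 + r) powr (- N)"
proof -
  interpret finite_measure M by fact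
  define m where "m = measure M (space M)"
  have N0: "N \<ge> 0"
    using dim by (simp add: N_def)
  define k where "k = DIM('a) - 2"
  have k: "real k = 2 * N"
    using dim by (simp add: k_def N_def)
  define p where "p r = (\<integral>z. cos (r * (w z \<bullet> e)) \<partial>M)" for r
  define p1 where "p1 r = (\<integral>z. - ((w z \<bullet> e) * sin (r * (w z \<bullet> e))) \<partial>M)" for r
  define p2 where "p2 r = (\<integral>z. - ((w z \<bullet> e)\<^sup>2 * cos (r * (w z \<bullet> e))) \<partial>M)" for r
  have le1: "AE z in M. \<bar>w z \<bullet> e\<bar> \<le> 1"
    using unit by eventually_elim (use e abs_inner_le_1 in blast)
  have trig: "\<bar>a * sin x\<bar> \<le> 1" "\<bar>a * cos x\<bar> \<le> 1" if "\<bar>a\<bar> \<le> 1" for a x :: real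
    using that mult_mono[of "\<bar>a\<bar>" 1 "\<bar>sin x\<bar>" 1] mult_mono[of "\<bar>a\<bar>" 1 "\<bar>cos x\<bar>" 1] by (auto simp: abs_mult)
  have trig2: "\<bar>a\<^sup>2 * cos x\<bar> \<le> 1" if "\<bar>a\<bar> \<le> 1" for a x :: real
    using that by (intro trig(2)) (auto simp: abs_square_le_1)
  have int0: "integrable M (\<lambda>z. cos (r * (w z \<bullet> e)))" for r
    by (rule integrable_const_bound[where B=1]) auto
  have int1: "integrable M (\<lambda>z. - ((w z \<bullet> e) * sin (r * (w z \<bullet> e))))" for r
    by (rule integrable_const_bound[where B=1]) (use le1 trig(1) in \<open>auto elim!: eventually_mono\<close>)
  have int2: "integrable M (\<lambda>z. - ((w z \<bullet> e)\<^sup>2 * cos (r * (w z \<bullet> e))))" for r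
    by (rule integrable_const_bound[where B=1]) (use le1 trig2 in \<open>auto elim!: eventually_mono\<close>)
  have p: "(p has_real_derivative p1 r) (at r)" for r
    unfolding has_real_derivative_iff_has_vector_derivative p_def p1_def
  proof (rule has_vector_derivative_integral[where w="\<lambda>_. 1"])
    show "AE z in M. \<forall>s. ((\<lambda>s. cos (s * (w z \<bullet> e))) has_vector_derivative - ((w z \<bullet> e) * sin (s * (w z \<bullet> e)))) (at s)"
      unfolding has_real_derivative_iff_has_vector_derivative[symmetric]
      by (auto intro!: derivative_eq_intros)
  qed (use int0 le1 trig(1) in \<open>auto elim!: eventually_mono\<close>)
  have p1: "(p1 has_real_derivative p2 r) (at r)" for r
    unfolding has_real_derivative_iff_has_vector_derivative p1_def p2_def
  proof (rule has_vector_derivative_integral[where w="\<lambda>_. 1"])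
    show "AE z in M. \<forall>s. ((\<lambda>s. - ((w z \<bullet> e) * sin (s * (w z \<bullet> e)))) has_vector_derivative
       - ((w z \<bullet> e)\<^sup>2 * cos (s * (w z \<bullet> e)))) (at s)"
      unfolding has_real_derivative_iff_has_vector_derivative[symmetric]
      by (auto intro!: derivative_eq_intros simp: power2_eq_square)
  qed (use int1 le1 trig2 in \<open>auto elim!: eventually_mono\<close>)
  have m0: "m \<ge> 0" by (simp add: m_def)
  have bound: "\<bar>p r\<bar> \<le> m" "\<bar>p1 r\<bar> \<le> m" for r
  proof -
    have "\<bar>p r\<bar> \<le> (\<integral>z. 1 \<partial>M)"
      unfolding p_def using int0 by (intro integral_abs_bound[THEN order_trans] integral_mono_AE) auto
    then show "\<bar>p r\<bar> \<le> m" by (simp add: m_def)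
    have "\<bar>p1 r\<bar> \<le> (\<integral>z. 1 \<partial>M)"
      unfolding p1_def using int1 le1 trig(1)
      by (intro integral_abs_bound[THEN order_trans] integral_mono_AE) (auto elim!: eventually_mono)
    then show "\<bar>p1 r\<bar> \<le> m" by (simp add: m_def)
  qed
  obtain B where B: "finite B" "card B = k" "\<And>b. b \<in> B \<Longrightarrow> norm b = 1"
    "\<And>b. b \<in> B \<Longrightarrow> n \<bullet> b = 0" "\<And>b. b \<in> B \<Longrightarrow> e \<bullet> b = 0"
    "\<And>x. (norm x)\<^sup>2 = (x \<bullet> n)\<^sup>2 + (x \<bullet> e)\<^sup>2 + (\<Sum>b\<in>B. (x \<bullet> b)\<^sup>2)"
    using orthonormal_pair_completion[OF n e ne] unfolding k_def by metis
  \<comment> \<open>The Bessel equation multiplied by r. It is \<open>rotation_identity\<close> for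
    h t = sin (r t), summed over the \<open>k\<close> vectors of \<open>B\<close>; these complete
    \<open>n\<close> and \<open>e\<close> to an orthonormal basis, so the squares (w z \<bullet>
    b)^2 add up to 1 - (w z \<bullet> e)^2.\<close>
  have ode: "r * (p2 r + p r) = - real k * p1 r" for r
  proof -
    have intb: "integrable M (\<lambda>z. (w z \<bullet> b)\<^sup>2 * (r * cos (r * (w z \<bullet> e))))" if "b \<in> B" for b
    proof (rule integrable_const_bound[where B="\<bar>r\<bar>"])
      show "AE z in M. norm ((w z \<bullet> b)\<^sup>2 * (r * cos (r * (w z \<bullet> e)))) \<le> \<bar>r\<bar>"
        using unit
      proof eventually_elim
        case (elim z)
        then have "\<bar>w z \<bullet> b\<bar> \<le> 1" using B(3)[OF that] abs_inner_le_1 by auto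
        then have "\<bar>(w z \<bullet> b)\<^sup>2 * cos (r * (w z \<bullet> e))\<bar> \<le> 1"
          by (intro trig(2)) (auto simp: abs_square_le_1)
        then show ?case
          using mult_left_mono[of "\<bar>(w z \<bullet> b)\<^sup>2 * cos (r * (w z \<bullet> e))\<bar>" 1 "\<bar>r\<bar>"]
          by (simp add: abs_mult mult_ac)
      qed
    qed measurable
    have "(\<integral>z. (w z \<bullet> e) * sin (r * (w z \<bullet> e)) - (w z \<bullet> b)\<^sup>2 * (r * cos (r * (w z \<bullet> e))) \<partial>M) = 0"
      if "b \<in> B" for b
    proof (rule rotation_identity[where h="\<lambda>t. sin (r * t)" and h'="\<lambda>t. r * cos (r * t)" and K="1 + \<bar>r\<bar>" and n=n])
      show "AE z in M. norm (w z) = 1" using unit by auto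
      show "\<bar>sin (r * t)\<bar> \<le> 1 + \<bar>r\<bar>" for t
        using abs_sin_le_one[of "r * t"] by linarith
      show "\<bar>r * cos (r * t)\<bar> \<le> 1 + \<bar>r\<bar>" for t
        using mult_left_mono[OF abs_cos_le_one[of "r * t"], of "\<bar>r\<bar>"] unfolding abs_mult by linarith
    qed (use fin inv B that e ne in \<open>auto intro!: derivative_eq_intros\<close>)
    then have "(\<Sum>b\<in>B. \<integral>z. (w z \<bullet> e) * sin (r * (w z \<bullet> e)) - (w z \<bullet> b)\<^sup>2 * (r * cos (r * (w z \<bullet> e))) \<partial>M) = 0"
      by simp
    then have "(\<integral>z. (\<Sum>b\<in>B. (w z \<bullet> e) * sin (r * (w z \<bullet> e)) - (w z \<bullet> b)\<^sup>2 * (r * cos (r * (w z \<bullet> e)))) \<partial>M) = 0"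
      using int1[of r] intb by (subst Bochner_Integration.integral_sum) auto
    also have "(\<integral>z. (\<Sum>b\<in>B. (w z \<bullet> e) * sin (r * (w z \<bullet> e)) - (w z \<bullet> b)\<^sup>2 * (r * cos (r * (w z \<bullet> e)))) \<partial>M)
       = (\<integral>z. - real k * (- ((w z \<bullet> e) * sin (r * (w z \<bullet> e)))) - r * (cos (r * (w z \<bullet> e)) + - ((w z \<bullet> e)\<^sup>2 * cos (r * (w z \<bullet> e)))) \<partial>M)"
    proof (rule integral_cong_AE)
      show "AE z in M. (\<Sum>b\<in>B. (w z \<bullet> e) * sin (r * (w z \<bullet> e)) - (w z \<bullet> b)\<^sup>2 * (r * cos (r * (w z \<bullet> e)))) =
         - real k * (- ((w z \<bullet> e) * sin (r * (w z \<bullet> e)))) - r * (cos (r * (w z \<bullet> e)) + - ((w z \<bullet> e)\<^sup>2 * cos (r * (w z \<bullet> e))))"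
        using unit
      proof eventually_elim
        case (elim z)
        then have *: "(\<Sum>b\<in>B. (w z \<bullet> b)\<^sup>2) = 1 - (w z \<bullet> e)\<^sup>2"
          using B(6)[of "w z"] by simp
        show ?case
          unfolding sum_subtractf sum_constant B(2) sum_distrib_right[symmetric] *
          by (simp add: algebra_simps)
      qed
    qed measurable
    also have "\<dots> = - real k * p1 r - r * (p r + p2 r)"
      unfolding p_def p1_def p2_def using int0 int1 int2
      by (subst Bochner_Integration.integral_diff integral_mult_right_zero Bochner_Integration.integral_add; simp?)+
    finally show ?thesis by (simp add: algebra_simps)
  qed
  \<comment> \<open>The function q = r powr N * p has no first-order term in its equation: q'' + (1
    - (N^2 - N) / r^2) q = 0. Then r powr N * A is q', and \<open>E\<close> is the energy q'^2 +
    q^2, with |E'| <= c / r^2 * E. As c / r^2 is integrable on [1, infinity), the bounded weight exp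
    (c / r) makes the energy decrease.\<close>
  define c where "c = \<bar>N\<^sup>2 - N\<bar>"
  define A where "A r = p1 r + N * p r / r" for r
  define E where "E r = r ^ k * ((A r)\<^sup>2 + (p r)\<^sup>2)" for r
  have decr: "E r * exp (c / r) \<le> E 1 * exp (c / 1)" if "r \<ge> 1" for r
  proof (rule DERIV_nonpos_imp_nonincreasing[OF that])
    fix x :: real assume "1 \<le> x" "x \<le> r"
    then have x: "x > 0" by simp
    have pp: "p2 x = - p x - 2 * N * p1 x / x"
      using ode[of x] x k by (simp add: field_simps)
    have dA: "(A has_real_derivative (- p x - N / x * A x + (N\<^sup>2 - N) * p x / x\<^sup>2)) (at x)"
      unfolding A_def using x
      by (auto intro!: derivative_eq_intros p p1 simp: pp field_simps power2_eq_square)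
    have dk: "((\<lambda>x. x ^ k) has_real_derivative 2 * N / x * x ^ k) (at x)"
    proof -
      have "real k * x ^ (k - Suc 0) = real k / x * x ^ k"
        using x by (cases k) auto
      then show ?thesis
        using DERIV_pow[of k x UNIV] unfolding k by simp
    qed
    have dE: "(E has_real_derivative x ^ k * (2 * (N\<^sup>2 - N) * A x * p x / x\<^sup>2)) (at x)"
    proof -
      have "p1 x = A x - N / x * p x" by (simp add: A_def)
      then have p': "(p has_real_derivative A x - N / x * p x) (at x)"
        using p[of x] by simp
      have "((\<lambda>x. (A x)\<^sup>2 + (p x)\<^sup>2) has_real_derivative
          2 * A x * (- p x - N / x * A x + (N\<^sup>2 - N) * p x / x\<^sup>2) + 2 * p x * (A x - N / x * p x)) (at x)"
        by (auto intro!: derivative_eq_intros dA p')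
      from DERIV_mult[OF dk this] show ?thesis
        unfolding E_def by (rule DERIV_cong) (simp add: algebra_simps power2_eq_square add_divide_distrib diff_divide_distrib)
    qed
    have "((\<lambda>x. E x * exp (c / x)) has_real_derivative
       exp (c / x) * (x ^ k * (2 * (N\<^sup>2 - N) * A x * p x / x\<^sup>2) - c / x\<^sup>2 * E x)) (at x)"
      using x by (auto intro!: derivative_eq_intros dE simp: field_simps power2_eq_square)
    moreover have "x ^ k * (2 * (N\<^sup>2 - N) * A x * p x / x\<^sup>2) \<le> c / x\<^sup>2 * E x"
    proof -
      have "2 * (A x * p x) \<le> (A x)\<^sup>2 + (p x)\<^sup>2" "- (2 * (A x * p x)) \<le> (A x)\<^sup>2 + (p x)\<^sup>2"
        using sum_squares_bound[of "A x" "p x"] sum_squares_bound[of "- A x" "p x"] by simp_all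
      then have "\<bar>2 * (A x * p x)\<bar> \<le> (A x)\<^sup>2 + (p x)\<^sup>2" by linarith
      then have "\<bar>N\<^sup>2 - N\<bar> * \<bar>2 * (A x * p x)\<bar> \<le> c * ((A x)\<^sup>2 + (p x)\<^sup>2)"
        unfolding c_def by (intro mult_left_mono) auto
      then have "(N\<^sup>2 - N) * (2 * (A x * p x)) \<le> c * ((A x)\<^sup>2 + (p x)\<^sup>2)"
        unfolding abs_mult[symmetric] by linarith
      then have "x ^ k / x\<^sup>2 * ((N\<^sup>2 - N) * (2 * (A x * p x))) \<le> x ^ k / x\<^sup>2 * (c * ((A x)\<^sup>2 + (p x)\<^sup>2))"
        using x by (intro mult_left_mono) auto
      then show ?thesis by (simp add: E_def mult_ac)
    qed
    ultimately show "\<exists>y. ((\<lambda>x. E x * exp (c / x)) has_real_derivative y) (at x) \<and> y \<le> 0"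
      by (intro exI conjI) (auto intro!: mult_nonneg_nonpos)
  qed
  \<comment> \<open>\<open>L * m\<close> dominates the square root of the weighted energy at r = 1,
    where |A 1| <= (1 + N) m and |p 1| <= m.\<close>
  define L where "L = sqrt (((1 + N)\<^sup>2 + 1) * exp c)"
  have L1: "L \<ge> 1"
  proof -
    have "(1::real) * 1 \<le> ((1 + N)\<^sup>2 + 1) * exp c"
      by (intro mult_mono) (auto simp: c_def)
    then show ?thesis by (simp add: L_def)
  qed
  have E1: "E 1 * exp (c / 1) \<le> (L * m)\<^sup>2"
  proof -
    have "\<bar>A 1\<bar> \<le> (1 + N) * m"
      using bound(2)[of 1] mult_left_mono[OF bound(1)[of 1] N0] N0 abs_triangle_ineq[of "p1 1" "N * p 1"]
      by (simp add: A_def distrib_right abs_mult)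
    then have "(A 1)\<^sup>2 \<le> ((1 + N) * m)\<^sup>2"
      by (rule abs_le_square_iff[THEN iffD1, OF order_trans]) simp
    moreover have "(p 1)\<^sup>2 \<le> m\<^sup>2"
      using bound(1)[of 1] by (simp add: abs_le_square_iff[symmetric])
    ultimately have "E 1 \<le> ((1 + N)\<^sup>2 + 1) * m\<^sup>2"
      unfolding power_mult_distrib by (simp add: E_def distrib_right)
    then have "E 1 * exp c \<le> ((1 + N)\<^sup>2 + 1) * m\<^sup>2 * exp c"
      by (intro mult_right_mono) auto
    then show ?thesis
      by (simp add: L_def power_mult_distrib mult_ac)
  qed
  \<comment> \<open>The factor 2 powr N pays for writing (1 + r) / 2 instead of r. For r >= 1 it is
    at most r; for r < 1 it is at most 1 and the trivial bound \<open>m\<close> suffices.\<close>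
  have "\<bar>p r\<bar> \<le> 2 powr N * L * m * (1 + r) powr (- N)"
  proof (cases "r \<ge> 1")
    case True
    have "(r powr N * \<bar>p r\<bar>)\<^sup>2 = r ^ k * (p r)\<^sup>2"
    proof -
      have "(r powr N)\<^sup>2 = r powr (real k)"
        using True unfolding power2_eq_square k by (simp flip: powr_add)
      then show ?thesis
        using True by (simp add: power_mult_distrib powr_realpow)
    qed
    also have "\<dots> \<le> E r * 1"
      using True by (simp add: E_def)
    also have "\<dots> \<le> E r * exp (c / r)"
      using True by (intro mult_left_mono) (auto simp: E_def c_def)
    also have "\<dots> \<le> (L * m)\<^sup>2"
      using decr[OF True] E1 by simp
    finally have "r powr N * \<bar>p r\<bar> \<le> L * m"
      by (rule power2_le_imp_le) (use L1 m0 in auto)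
    then have "\<bar>p r\<bar> \<le> L * m * r powr (- N)"
      using True by (simp add: powr_minus field_simps)
    also have "\<dots> \<le> L * m * ((1 + r) / 2) powr (- N)"
      using True N0 L1 m0 by (intro mult_left_mono powr_mono2') auto
    also have "((1 + r) / 2) powr (- N) = 2 powr N * (1 + r) powr (- N)"
      using True by (simp add: powr_divide powr_minus field_simps)
    finally show ?thesis
      by (simp add: mult_ac)
  next
    case False
    have "1 \<le> ((1 + r) / 2) powr (- N)"
      using powr_mono2'[of "- N" "(1 + r) / 2" 1] False r N0 by simp
    also have "\<dots> = 2 powr N * (1 + r) powr (- N)"
      using r by (simp add: powr_divide powr_minus field_simps)
    finally have "(1 * m) * 1 \<le> (L * m) * (2 powr N * (1 + r) powr (- N))"
      using L1 m0 by (intro mult_mono) auto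
    then show ?thesis
      using bound(1)[of r] by (simp add: mult_ac)
  qed
  then show ?thesis
    by (simp add: p_def L_def c_def m_def)
qed

section \<open>Bounded integrals and measurability\<close>

lemma integral_swap_bounded:
  fixes F :: "'x \<Rightarrow> 'y \<Rightarrow> 'b::{banach, second_countable_topology}"
  assumes A: "finite_measure A" and B: "finite_measure B"
    and [measurable]: "(\<lambda>(x, y). F x y) \<in> borel_measurable (A \<Otimes>\<^sub>M B)"
    and C: "\<And>x y. norm (F x y) \<le> C"
  shows "(\<integral>y. \<integral>x. F x y \<partial>A \<partial>B) = (\<integral>x. \<integral>y. F x y \<partial>B \<partial>A)"
proof -
  interpret A: finite_measure A by fact
  interpret B: finite_measure B by fact
  interpret AB: pair_sigma_finite A B ..
  interpret P: finite_measure "A \<Otimes>\<^sub>M B"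
    by (intro finite_measure_pair_measure A B)
  show ?thesis
    by (rule AB.Fubini_integral) (rule P.integrable_const_bound[where B=C]; use C in auto)
qed

lemma norm_integral_le_const:
  fixes F :: "'x \<Rightarrow> 'b::{banach, second_countable_topology}"
  assumes "finite_measure M" "\<And>x. norm (F x) \<le> C" "C \<ge> 0"
  shows "norm (\<integral>x. F x \<partial>M) \<le> C * measure M (space M)"
proof (cases "integrable M F")
  case True
  interpret finite_measure M by fact
  have "norm (\<integral>x. F x \<partial>M) \<le> (\<integral>x. norm (F x) \<partial>M)"
    by (rule integral_norm_bound)
  also have "\<dots> \<le> (\<integral>x. C \<partial>M)"
    using True assms by (intro integral_mono) auto
  finally show ?thesis by (simp add: mult.commute)
next
  case False
  then show ?thesis using assms(3) by (simp add: not_integrable_integral_eq)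
qed

lemma borel_measurable_cis [measurable]: "cis \<in> borel_measurable borel"
  unfolding cis_conv_exp by (intro borel_measurable_continuous_onI continuous_intros)

lemma borel_measurable_fst_snd [measurable]:
  "(fst :: 'a::euclidean_space \<times> 'b::euclidean_space \<Rightarrow> 'a) \<in> borel_measurable borel"
  "(snd :: 'a::euclidean_space \<times> 'b::euclidean_space \<Rightarrow> 'b) \<in> borel_measurable borel"
  by (auto intro!: borel_measurable_continuous_onI continuous_intros)

lemma borel_measurable_orthogonal_transformation [measurable_dest]:
  fixes g :: "'a::euclidean_space \<Rightarrow> 'a"
  assumes "orthogonal_transformation g"
  shows "g \<in> borel_measurable borel"
  using assms by (intro borel_measurable_continuous_onI linear_continuous_on)
    (simp add: linear_linear orthogonal_transformation_linear)

section \<open>Projection onto the hyperplane orthogonal to a unit vector\<close>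

definition perp :: "'a::real_inner \<Rightarrow> 'a \<Rightarrow> 'a" where
  "perp n z = z - (z \<bullet> n) *\<^sub>R n"

definition perp_dir :: "'a::real_inner \<Rightarrow> 'a \<Rightarrow> 'a" where
  "perp_dir n z = perp n z /\<^sub>R norm (perp n z)"

text \<open>For unit vectors this is the squared sine of their angle. Truncation at 0 keeps it in
  [0, 1] for all arguments, as the pointwise bound in \<open>integral_swap_bounded\<close>
  demands.\<close>

definition sin2 :: "'a::real_inner \<Rightarrow> 'a \<Rightarrow> real" where
  "sin2 n z = max 0 (1 - (z \<bullet> n)\<^sup>2)"

lemma borel_measurable_perp [measurable]:
  fixes f g :: "'x \<Rightarrow> 'a::euclidean_space"
  assumes [measurable]: "f \<in> borel_measurable M" "g \<in> borel_measurable M"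
  shows "(\<lambda>x. perp (f x) (g x)) \<in> borel_measurable M"
    and "(\<lambda>x. perp_dir (f x) (g x)) \<in> borel_measurable M"
    and "(\<lambda>x. sin2 (f x) (g x)) \<in> borel_measurable M"
  unfolding perp_dir_def perp_def sin2_def by measurable

lemma sin2_bounds: "0 \<le> sin2 n z" "sin2 n z \<le> 1" "\<bar>sin2 n z\<bar> \<le> 1"
  by (auto simp: sin2_def)

lemma sin2_commute: "sin2 n z = sin2 z n"
  by (simp add: sin2_def inner_commute)

lemma norm_perp:
  assumes "norm n = 1"
  shows "(norm (perp n z))\<^sup>2 = (norm z)\<^sup>2 - (z \<bullet> n)\<^sup>2"
  using assms unfolding power2_norm_eq_inner perp_def norm_eq_1
  by (simp add: inner_simps inner_commute power2_eq_square algebra_simps)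

lemma norm_perp_sin2:
  assumes "norm n = 1" "norm z = 1"
  shows "(norm (perp n z))\<^sup>2 = sin2 n z"
  using norm_perp[OF assms(1), of z] zero_le_power2[of "norm (perp n z)"] assms
  by (simp add: sin2_def del: zero_le_power2)

lemma inner_perp:
  assumes "norm n = 1"
  shows "perp n z \<bullet> n = 0" "perp_dir n z \<bullet> n = 0"
  using assms by (auto simp: perp_def perp_dir_def inner_simps norm_eq_1)

text \<open>Only the projection of \<open>u\<close> enters the phase. This is how an average over
  \<open>z\<close> becomes a value of the function \<open>G\<close> at a projected vector.\<close>

lemma inner_perp_dir:
  assumes "norm n = 1"
  shows "perp_dir n z \<bullet> u = perp n u \<bullet> perp_dir n z"
  using inner_perp(2)[OF assms, of z] by (simp add: perp_def[of n u] inner_simps inner_commute)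

lemma norm_perp_dir: "perp n z \<noteq> 0 \<Longrightarrow> norm (perp_dir n z) = 1"
  by (simp add: perp_dir_def)

lemma orthogonal_transformation_perp:
  assumes "orthogonal_transformation g"
  shows "perp (g n) (g z) = g (perp n z)" "perp_dir (g n) (g z) = g (perp_dir n z)"
    "sin2 (g n) (g z) = sin2 n z"
proof -
  have 1: "linear g" and 2: "g x \<bullet> g y = x \<bullet> y" for x y
    using assms by (auto simp: orthogonal_transformation_def)
  show *: "perp (g n) (g z) = g (perp n z)"
    by (simp add: perp_def 2 linear_diff[OF 1] linear_scale[OF 1])
  show "perp_dir (g n) (g z) = g (perp_dir n z)"
    using orthogonal_transformation_norm[OF assms] by (simp add: perp_dir_def * linear_scale[OF 1])
  show "sin2 (g n) (g z) = sin2 n z"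
    by (simp add: sin2_def 2)
qed

section \<open>Averages over spheres in hyperplanes\<close>

locale invariant_sphere_measure = finite_measure \<nu> for \<nu> :: "'a::euclidean_space measure" +
  assumes sets_nu [simp, measurable_cong]: "sets \<nu> = sets borel"
    and unit_nu: "AE z in \<nu>. norm z = 1"
    and inv_nu: "\<And>g. orthogonal_transformation g \<Longrightarrow> distr \<nu> borel g = \<nu>"
    and dim: "DIM('a) \<ge> 2"
begin

lemma space_nu [simp]: "space \<nu> = UNIV"
  using sets_eq_imp_space_eq[OF sets_nu] by simp

lemma integral_nu_orthogonal:
  fixes F :: "'a \<Rightarrow> 'b::{banach, second_countable_topology}"
  assumes "orthogonal_transformation g" and [measurable]: "F \<in> borel_measurable borel"
  shows "(\<integral>z. F (g z) \<partial>\<nu>) = (\<integral>z. F z \<partial>\<nu>)"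
proof -
  note [measurable] = borel_measurable_orthogonal_transformation[OF assms(1)]
  have "(\<integral>z. F z \<partial>\<nu>) = (\<integral>z. F z \<partial>distr \<nu> borel g)"
    using inv_nu[OF assms(1)] by simp
  then show ?thesis
    by (simp add: integral_distr)
qed

text \<open>Reflections make the second moment equal in all unit directions, and over an orthonormal
  basis these moments add up to the total mass; each is therefore the mass divided by d.\<close>

lemma integral_sin2:
  assumes n: "norm n = 1"
  shows "(\<integral>z. sin2 n z \<partial>\<nu>) = measure \<nu> UNIV * (1 - 1 / DIM('a))"
proof -
  have int: "integrable \<nu> (\<lambda>z. (z \<bullet> b)\<^sup>2)" if "norm b = 1" for b
  proof (rule integrable_const_bound[where B=1])
    show "AE z in \<nu>. norm ((z \<bullet> b)\<^sup>2) \<le> 1"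
      using unit_nu by eventually_elim (use that abs_inner_le_1 in \<open>auto simp: abs_square_le_1\<close>)
  qed measurable
  have eq: "(\<integral>z. (z \<bullet> b)\<^sup>2 \<partial>\<nu>) = (\<integral>z. (z \<bullet> n)\<^sup>2 \<partial>\<nu>)" if b: "norm b = 1" for b
  proof -
    obtain g where g: "orthogonal_transformation g" "g b = n"
      using reflection_exists[of b n] b n by metis
    have "(\<integral>z. (z \<bullet> n)\<^sup>2 \<partial>\<nu>) = (\<integral>z. (g z \<bullet> n)\<^sup>2 \<partial>\<nu>)"
      by (rule integral_nu_orthogonal[OF g(1), symmetric]) measurable
    also have "\<dots> = (\<integral>z. (z \<bullet> b)\<^sup>2 \<partial>\<nu>)"
      using g by (auto simp: orthogonal_transformation_def)
    finally show ?thesis by simp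
  qed
  have "real DIM('a) * (\<integral>z. (z \<bullet> n)\<^sup>2 \<partial>\<nu>) = (\<Sum>b\<in>Basis. \<integral>z. (z \<bullet> b)\<^sup>2 \<partial>\<nu>)"
    using eq by simp
  also have "\<dots> = (\<integral>z. (\<Sum>b\<in>Basis. (z \<bullet> b)\<^sup>2) \<partial>\<nu>)"
    using int by (subst Bochner_Integration.integral_sum) auto
  also have "\<dots> = (\<integral>z. 1 \<partial>\<nu>)"
  proof (rule integral_cong_AE)
    show "AE z in \<nu>. (\<Sum>b\<in>Basis. (z \<bullet> b)\<^sup>2) = 1"
      using unit_nu
      by eventually_elim (simp add: sum_inner_orthogonal_transformation_Basis[OF orthogonal_transformation_id])
  qed measurable
  finally have "(\<integral>z. (z \<bullet> n)\<^sup>2 \<partial>\<nu>) = measure \<nu> UNIV / DIM('a)"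
    by (simp add: field_simps)
  moreover have "(\<integral>z. sin2 n z \<partial>\<nu>) = (\<integral>z. 1 - (z \<bullet> n)\<^sup>2 \<partial>\<nu>)"
  proof (rule integral_cong_AE)
    show "AE z in \<nu>. sin2 n z = 1 - (z \<bullet> n)\<^sup>2"
      using unit_nu by eventually_elim (use n norm_perp norm_perp_sin2 in \<open>fastforce\<close>)
  qed measurable
  ultimately show ?thesis
    using int[OF n] by (simp add: algebra_simps)
qed

text \<open>Up to a constant factor, \<^term>\<open>G n\<close> is the Fourier transform of the uniform measure on the unit
  sphere of the hyperplane orthogonal to \<^term>\<open>n\<close>; the weight \<^term>\<open>sin2\<close> removes the points \<open>\<plusminus>n\<close>, which
  have no direction in that hyperplane.\<close>

definition G :: "'a \<Rightarrow> 'a \<Rightarrow> complex" where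
  "G n \<zeta> = (\<integral>z. sin2 n z * cis (\<zeta> \<bullet> perp_dir n z) \<partial>\<nu>)"

lemma borel_measurable_G [measurable]:
  assumes [measurable]: "f \<in> borel_measurable M" "g \<in> borel_measurable M"
  shows "(\<lambda>x. G (f x) (g x)) \<in> borel_measurable M"
  unfolding G_def by measurable

lemma norm_G_le: "norm (G n \<zeta>) \<le> measure \<nu> UNIV"
proof -
  have "norm (G n \<zeta>) \<le> 1 * measure \<nu> (space \<nu>)"
    unfolding G_def by (rule norm_integral_le_const[OF finite_measure_axioms]) (simp_all add: norm_mult sin2_bounds)
  then show ?thesis by simp
qed

lemma G_orthogonal:
  assumes g: "orthogonal_transformation g"
  shows "G (g n) (g \<zeta>) = G n \<zeta>"
proof -
  have "G (g n) (g \<zeta>) = (\<integral>z. sin2 (g n) (g z) * cis (g \<zeta> \<bullet> perp_dir (g n) (g z)) \<partial>\<nu>)"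
    unfolding G_def by (rule integral_nu_orthogonal[OF g, symmetric]) measurable
  also have "\<dots> = G n \<zeta>"
    using g unfolding orthogonal_transformation_perp[OF g] G_def
    by (simp add: orthogonal_transformation_def)
  finally show ?thesis .
qed

text \<open>The constant of \<open>sphere_fourier_decay\<close> with the total mass split
  off.\<close>

definition decay_const :: real where
  "decay_const = 2 powr ((real DIM('a) - 2) / 2) * sqrt (((1 + (real DIM('a) - 2) / 2)\<^sup>2 + 1) *
     exp \<bar>((real DIM('a) - 2) / 2)\<^sup>2 - (real DIM('a) - 2) / 2\<bar>)"

lemma decay_const_ge_1: "decay_const \<ge> 1"
proof -
  have "(1::real) * 1 \<le> 2 powr ((real DIM('a) - 2) / 2) * sqrt (((1 + (real DIM('a) - 2) / 2)\<^sup>2 + 1) *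
     exp \<bar>((real DIM('a) - 2) / 2)\<^sup>2 - (real DIM('a) - 2) / 2\<bar>)"
  proof (rule mult_mono)
    show "1 \<le> (2::real) powr ((real DIM('a) - 2) / 2)"
      using dim by (intro ge_one_powr_ge_zero) auto
    have "(1::real) * 1 \<le> ((1 + (real DIM('a) - 2) / 2)\<^sup>2 + 1) *
     exp \<bar>((real DIM('a) - 2) / 2)\<^sup>2 - (real DIM('a) - 2) / 2\<bar>"
      by (intro mult_mono) auto
    then show "1 \<le> sqrt (((1 + (real DIM('a) - 2) / 2)\<^sup>2 + 1) *
     exp \<bar>((real DIM('a) - 2) / 2)\<^sup>2 - (real DIM('a) - 2) / 2\<bar>)"
      by simp
  qed auto
  then show ?thesis by (simp add: decay_const_def)
qed

text \<open>\<open>sphere_fourier_decay\<close> is applied to the map \<open>perp_dir n\<close> on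
  \<nu> with density \<open>sin2 n\<close>. An orthogonal map fixing \<open>n\<close> commutes with
  \<open>perp_dir n\<close> and preserves the density, so the image measure inherits the invariance;
  almost everywhere for the density the direction is a genuine unit vector.\<close>

lemma norm_G_decay:
  assumes n: "norm n = 1" and \<zeta>: "\<zeta> \<bullet> n = 0"
  shows "norm (G n \<zeta>) \<le> decay_const * measure \<nu> UNIV * (1 + norm \<zeta>) powr (- ((real DIM('a) - 2) / 2))"
proof (cases "\<zeta> = 0")
  case True
  \<comment> \<open>The zero frequency has no direction \<open>e\<close>; as
    \<open>decay_const\<close> is at least 1, the trivial bound is enough.\<close>
  have "measure \<nu> UNIV \<le> decay_const * measure \<nu> UNIV"
    using decay_const_ge_1 mult_right_mono[of 1 decay_const "measure \<nu> UNIV"] by simp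
  then show ?thesis
    using norm_G_le[of n \<zeta>] True by simp
next
  case False
  define r where "r = norm \<zeta>"
  define e where "e = \<zeta> /\<^sub>R r"
  have r: "r > 0" and e: "norm e = 1" and \<zeta>_eq: "\<zeta> = r *\<^sub>R e" and ne: "n \<bullet> e = 0"
    using False \<zeta> by (auto simp: r_def e_def inner_commute)
  define M where "M = density \<nu> (\<lambda>z. ennreal (sin2 n z))"
  have [simp, measurable_cong]: "sets M = sets borel"
    by (simp add: M_def)
  have [simp]: "space M = UNIV"
    by (simp add: M_def)
  have emM: "emeasure M UNIV \<le> emeasure \<nu> UNIV"
  proof -
    have "emeasure M UNIV = (\<integral>\<^sup>+z. ennreal (sin2 n z) \<partial>\<nu>)"
      unfolding M_def by (subst emeasure_density) auto
    also have "\<dots> \<le> (\<integral>\<^sup>+z. 1 \<partial>\<nu>)"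
      by (intro nn_integral_mono) (simp add: sin2_bounds)
    finally show ?thesis by simp
  qed
  interpret M: finite_measure M
    using emM emeasure_finite[of UNIV] by (intro finite_measureI) (auto simp: top_unique)
  have mM: "measure M UNIV \<le> measure \<nu> UNIV"
    using emM by (simp add: emeasure_eq_measure M.emeasure_eq_measure)
  have unit: "AE z in M. norm (perp_dir n z) = 1 \<and> perp_dir n z \<bullet> n = 0"
    unfolding M_def
  proof (subst AE_density)
    show "AE z in \<nu>. 0 < ennreal (sin2 n z) \<longrightarrow> norm (perp_dir n z) = 1 \<and> perp_dir n z \<bullet> n = 0"
      using unit_nu
    proof eventually_elim
      case (elim z)
      show ?case
        using norm_perp_sin2[OF n elim] inner_perp[OF n, of z] norm_perp_dir[of n z]
        by (cases "perp n z = 0") auto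
    qed
  qed measurable
  have inv: "distr M borel (\<lambda>z. g (perp_dir n z)) = distr M borel (perp_dir n)"
    if g: "orthogonal_transformation g" and gn: "g n = n" for g
  proof (rule measure_eqI)
    note [measurable] = borel_measurable_orthogonal_transformation[OF g]
    fix A assume "A \<in> sets (distr M borel (\<lambda>z. g (perp_dir n z)))"
    then have [measurable]: "A \<in> sets borel" by simp
    have *: "emeasure M {z. F z \<in> A} = (\<integral>\<^sup>+z. ennreal (sin2 n z) * indicator A (F z) \<partial>\<nu>)"
      if [measurable]: "F \<in> borel_measurable borel" for F
      unfolding M_def by (subst emeasure_density) (auto intro!: nn_integral_cong split: split_indicator)
    have "emeasure (distr M borel (\<lambda>z. g (perp_dir n z))) A = (\<integral>\<^sup>+z. ennreal (sin2 n z) * indicator A (g (perp_dir n z)) \<partial>\<nu>)"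
      by (subst emeasure_distr) (auto simp: vimage_def *)
    also have "\<dots> = (\<integral>\<^sup>+z. ennreal (sin2 n (g z)) * indicator A (perp_dir n (g z)) \<partial>\<nu>)"
      using orthogonal_transformation_perp[OF g, of n] gn by simp
    also have "\<dots> = (\<integral>\<^sup>+z. ennreal (sin2 n z) * indicator A (perp_dir n z) \<partial>distr \<nu> borel g)"
      by (subst nn_integral_distr) auto
    also have "\<dots> = emeasure (distr M borel (perp_dir n)) A"
      using inv_nu[OF g] by (subst emeasure_distr) (auto simp: vimage_def *)
    finally show "emeasure (distr M borel (\<lambda>z. g (perp_dir n z))) A = emeasure (distr M borel (perp_dir n)) A" .
  qed simp
  have G: "G n \<zeta> = (\<integral>z. cis (r * (perp_dir n z \<bullet> e)) \<partial>M)"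
    unfolding G_def M_def by (subst integral_density) (auto simp: sin2_bounds \<zeta>_eq inner_commute scaleR_conv_of_real)
  have int: "integrable M (\<lambda>z. cis (r * (perp_dir n z \<bullet> e)))"
    by (rule M.integrable_const_bound[where B=1]) auto
  have Re: "Re (G n \<zeta>) = (\<integral>z. cos (r * (perp_dir n z \<bullet> e)) \<partial>M)"
    unfolding G using int by (simp flip: integral_Re)
  have Im: "Im (G n \<zeta>) = (\<integral>z. sin (r * (perp_dir n z \<bullet> e)) \<partial>M)"
    unfolding G using int by (simp flip: integral_Im)
  \<comment> \<open>The reflection taking \<open>e\<close> to \<open>- e\<close> fixes
    \<open>n\<close>, so the law of the directions is symmetric in \<open>e\<close> and the sine
    averages out.\<close>
  have "Im (G n \<zeta>) = 0"
  proof -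
    obtain g where g: "orthogonal_transformation g" "g e = - e" "g n = n"
      using reflection_exists[of e "- e"] ne by (metis inner_minus_right neg_equal_0_iff_equal norm_minus_cancel)
    note [measurable] = borel_measurable_orthogonal_transformation[OF g(1)]
    have ge: "g x \<bullet> e = - (x \<bullet> e)" for x
      using g(1,2) by (metis inner_minus_right minus_minus orthogonal_transformation_def)
    have "(\<integral>z. sin (r * (perp_dir n z \<bullet> e)) \<partial>M) = (\<integral>x. sin (r * (x \<bullet> e)) \<partial>distr M borel (perp_dir n))"
      by (subst integral_distr) auto
    also have "\<dots> = (\<integral>z. sin (r * (g (perp_dir n z) \<bullet> e)) \<partial>M)"
      unfolding inv[OF g(1,3), symmetric] by (subst integral_distr) auto
    also have "\<dots> = - (\<integral>z. sin (r * (perp_dir n z \<bullet> e)) \<partial>M)"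
      by (simp add: ge)
    finally show ?thesis by (simp add: Im)
  qed
  then have "norm (G n \<zeta>) = \<bar>\<integral>z. cos (r * (perp_dir n z \<bullet> e)) \<partial>M\<bar>"
    by (simp add: cmod_def Re)
  also have "\<dots> \<le> decay_const * measure M (space M) * (1 + r) powr (- ((real DIM('a) - 2) / 2))"
    unfolding decay_const_def
    by (rule sphere_fourier_decay[OF M.finite_measure_axioms _ unit inv dim n e ne]) (use r in auto)
  also have "\<dots> \<le> decay_const * measure \<nu> UNIV * (1 + r) powr (- ((real DIM('a) - 2) / 2))"
    using mM decay_const_ge_1 by (intro mult_right_mono mult_left_mono) auto
  finally show ?thesis by (simp add: r_def)
qed

end

section \<open>The Fourier transform of an invariant measure on the triangles\<close>

context invariant_sphere_measure
begin

text \<open>Both arguments are multiples of vectors of the same length rho, the sine of the angle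
  between \<open>u\<close> and \<open>z\<close>. The decay of the factors gives ((1 + \<beta> rho)
  (1 + c rho)) powr (- N), and since rho <= 1 the base is at least 1 + Q rho^2 with Q = c + \<beta>
  c.\<close>

lemma integral_G_G_le:
  fixes \<beta> c :: real
  defines "N \<equiv> (real DIM('a) - 2) / 2"
  assumes u: "norm u = 1" and \<beta>: "\<beta> \<ge> 0" and c: "c \<ge> 0"
  shows "(\<integral>z. norm (G z (\<beta> *\<^sub>R perp z u)) * norm (G u (c *\<^sub>R perp u z)) \<partial>\<nu>)
    \<le> (decay_const * measure \<nu> UNIV)\<^sup>2 * 2 powr N * (4 * 4 powr N * measure \<nu> UNIV) * (1 + c + \<beta> * c) powr (- N)"
proof -
  define Q where "Q = c + \<beta> * c"
  \<comment> \<open>With this choice (1 + Q) (rho^2 + \<epsilon>) = (1 + Q) rho^2 + 1 <= 2 (1 + Q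
    rho^2). Hence (1 + Q) powr (- N) splits off and leaves the moment of
    \<open>sphere_negative_moment\<close>, whose bound does not involve \<epsilon>.\<close>
  define \<epsilon> where "\<epsilon> = 1 / (1 + Q)"
  define D where "D = decay_const * measure \<nu> UNIV"
  have Q: "Q \<ge> 0" using \<beta> c by (simp add: Q_def)
  have \<epsilon>: "\<epsilon> > 0" using Q by (simp add: \<epsilon>_def)
  have D: "D \<ge> 0" using decay_const_ge_1 by (simp add: D_def)
  have N0: "N \<ge> 0" using dim by (simp add: N_def)
  note moment = sphere_negative_moment[OF finite_measure_axioms sets_nu unit_nu inv_nu dim u \<epsilon>, folded N_def]
  have "AE z in \<nu>. norm (G z (\<beta> *\<^sub>R perp z u)) * norm (G u (c *\<^sub>R perp u z))
      \<le> D\<^sup>2 * 2 powr N * (1 + Q) powr (- N) * (1 - (z \<bullet> u)\<^sup>2 + \<epsilon>) powr (- N)"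
    using unit_nu
  proof eventually_elim
    case (elim z)
    define \<rho> where "\<rho> = norm (perp u z)"
    have \<rho>2: "\<rho>\<^sup>2 = 1 - (z \<bullet> u)\<^sup>2"
      using norm_perp[OF u, of z] elim by (simp add: \<rho>_def)
    have \<rho>': "norm (perp z u) = \<rho>"
      using norm_perp_sin2[OF u elim] norm_perp_sin2[OF elim u] sin2_commute[of u z]
      by (metis \<rho>_def norm_ge_zero power2_eq_iff_nonneg)
    have \<rho>01: "0 \<le> \<rho>" "\<rho>\<^sup>2 \<le> 1"
      by (simp_all add: \<rho>2) (simp add: \<rho>_def)
    have G1: "norm (G z (\<beta> *\<^sub>R perp z u)) \<le> D * (1 + \<beta> * \<rho>) powr (- N)"
      using norm_G_decay[OF elim, of "\<beta> *\<^sub>R perp z u"] inner_perp(1)[OF elim, of u] \<beta>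
      by (simp add: D_def N_def \<rho>')
    have G2: "norm (G u (c *\<^sub>R perp u z)) \<le> D * (1 + c * \<rho>) powr (- N)"
      using norm_G_decay[OF u, of "c *\<^sub>R perp u z"] inner_perp(1)[OF u, of z] c
      by (simp add: D_def N_def \<rho>_def)
    have "(1 + Q) / 2 * (\<rho>\<^sup>2 + \<epsilon>) = (\<rho>\<^sup>2 + Q * \<rho>\<^sup>2 + 1) / 2"
      using Q by (simp add: \<epsilon>_def field_simps)
    also have "\<dots> \<le> (2 + Q * \<rho>\<^sup>2) / 2"
      using \<rho>01 by simp
    also have "\<dots> \<le> 1 + Q * \<rho>\<^sup>2"
      using Q by simp
    also have "\<dots> \<le> (1 + \<beta> * \<rho>) * (1 + c * \<rho>)"
    proof -
      have "\<rho>\<^sup>2 \<le> \<rho>"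
        using \<rho>01 power_le_one_iff[of \<rho> 2] by (simp add: power2_eq_square mult_left_le)
      then have "c * \<rho>\<^sup>2 \<le> c * \<rho>" using c by (intro mult_left_mono)
      moreover have "0 \<le> \<beta> * \<rho>" using \<beta> \<rho>01 by simp
      ultimately show ?thesis by (simp add: Q_def algebra_simps power2_eq_square)
    qed
    finally have le: "(1 + Q) / 2 * (\<rho>\<^sup>2 + \<epsilon>) \<le> (1 + \<beta> * \<rho>) * (1 + c * \<rho>)" .
    have "norm (G z (\<beta> *\<^sub>R perp z u)) * norm (G u (c *\<^sub>R perp u z)) \<le>
       (D * (1 + \<beta> * \<rho>) powr (- N)) * (D * (1 + c * \<rho>) powr (- N))"
      using G1 G2 D by (intro mult_mono) auto
    also have "\<dots> = D\<^sup>2 * ((1 + \<beta> * \<rho>) * (1 + c * \<rho>)) powr (- N)"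
      using \<beta> c \<rho>01 by (simp add: powr_mult power2_eq_square)
    also have "\<dots> \<le> D\<^sup>2 * ((1 + Q) / 2 * (\<rho>\<^sup>2 + \<epsilon>)) powr (- N)"
    proof (intro mult_left_mono powr_mono2'[OF _ _ le])
      show "0 < (1 + Q) / 2 * (\<rho>\<^sup>2 + \<epsilon>)"
        using Q \<epsilon> by (intro mult_pos_pos add_nonneg_pos) auto
    qed (use N0 in auto)
    also have "\<dots> = D\<^sup>2 * 2 powr N * (1 + Q) powr (- N) * (\<rho>\<^sup>2 + \<epsilon>) powr (- N)"
    proof -
      have "((1 + Q) / 2 * (\<rho>\<^sup>2 + \<epsilon>)) powr (- N) = ((1 + Q) / 2) powr (- N) * (\<rho>\<^sup>2 + \<epsilon>) powr (- N)"
        by (rule powr_mult)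
      moreover have "((1 + Q) / 2) powr (- N) = 2 powr N * (1 + Q) powr (- N)"
        using Q by (simp add: powr_divide powr_minus field_simps)
      ultimately show ?thesis by simp
    qed
    finally show ?case by (simp add: \<rho>2)
  qed
  then have "(\<integral>z. norm (G z (\<beta> *\<^sub>R perp z u)) * norm (G u (c *\<^sub>R perp u z)) \<partial>\<nu>) \<le>
     (\<integral>z. D\<^sup>2 * 2 powr N * (1 + Q) powr (- N) * (1 - (z \<bullet> u)\<^sup>2 + \<epsilon>) powr (- N) \<partial>\<nu>)"
  proof (rule integral_mono_AE[rotated 2])
    show "integrable \<nu> (\<lambda>z. norm (G z (\<beta> *\<^sub>R perp z u)) * norm (G u (c *\<^sub>R perp u z)))"
    proof (rule integrable_const_bound[where B="measure \<nu> UNIV * measure \<nu> UNIV"])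
      show "AE z in \<nu>. norm (norm (G z (\<beta> *\<^sub>R perp z u)) * norm (G u (c *\<^sub>R perp u z))) \<le> measure \<nu> UNIV * measure \<nu> UNIV"
        using norm_G_le by (auto simp: abs_mult intro!: mult_mono always_eventually)
    qed measurable
  qed (use moment(1) in simp)
  also have "\<dots> = D\<^sup>2 * 2 powr N * (1 + Q) powr (- N) * (\<integral>z. (1 - (z \<bullet> u)\<^sup>2 + \<epsilon>) powr (- N) \<partial>\<nu>)"
    by simp
  also have "\<dots> \<le> D\<^sup>2 * 2 powr N * (1 + Q) powr (- N) * (4 * 4 powr N * measure \<nu> UNIV)"
    using moment(2) by (intro mult_left_mono) auto
  finally show ?thesis
    by (simp add: D_def Q_def mult_ac add.assoc)
qed

end

section \<open>Invariant measures on pairs of vectors spanning an equilateral triangle\<close>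

locale invariant_triangle_measure = finite_measure \<mu> for \<mu> :: "('a::euclidean_space \<times> 'a) measure" +
  assumes sets_mu [simp, measurable_cong]: "sets \<mu> = sets borel"
    and tri_mu: "AE x in \<mu>. norm (fst x) = 1 \<and> norm (snd x) = 1 \<and> norm (fst x - snd x) = 1"
    and inv_mu: "\<And>g. orthogonal_transformation g \<Longrightarrow> distr \<mu> borel (\<lambda>x. (g (fst x), g (snd x))) = \<mu>"
    and dim2: "DIM('a) \<ge> 2"
begin

lemma space_mu [simp]: "space \<mu> = UNIV"
  using sets_eq_imp_space_eq[OF sets_mu] by simp

lemma integral_mu_orthogonal:
  fixes F :: "'a \<times> 'a \<Rightarrow> 'b::{banach, second_countable_topology}"
  assumes "orthogonal_transformation g" and [measurable]: "F \<in> borel_measurable borel"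
  shows "(\<integral>x. F (g (fst x), g (snd x)) \<partial>\<mu>) = (\<integral>x. F x \<partial>\<mu>)"
proof -
  note [measurable] = borel_measurable_orthogonal_transformation[OF assms(1)]
  have "(\<integral>x. F x \<partial>\<mu>) = (\<integral>x. F x \<partial>distr \<mu> borel (\<lambda>x. (g (fst x), g (snd x))))"
    using inv_mu[OF assms(1)] by simp
  then show ?thesis
    by (simp add: integral_distr)
qed

abbreviation "\<nu> \<equiv> distr \<mu> borel fst"

sublocale nu: invariant_sphere_measure \<nu>
proof -
  interpret nu: finite_measure \<nu>
    by (rule finite_measure_distr) measurable
  show "invariant_sphere_measure \<nu>"
  proof
    show "AE z in \<nu>. norm z = 1"
      using tri_mu by (subst AE_distr_iff) (auto elim!: eventually_mono)
    fix g :: "'a \<Rightarrow> 'a" assume g: "orthogonal_transformation g"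
    note [measurable] = borel_measurable_orthogonal_transformation[OF g]
    have "distr \<nu> borel g = distr \<mu> borel (\<lambda>x. g (fst x))"
      by (subst distr_distr) (auto simp: comp_def)
    also have "\<dots> = distr (distr \<mu> borel (\<lambda>x. (g (fst x), g (snd x)))) borel fst"
      by (subst distr_distr) (auto simp: comp_def)
    finally show "distr \<nu> borel g = \<nu>"
      using inv_mu[OF g] by simp
  qed (use dim2 in auto)
qed

lemma measure_nu: "measure \<nu> UNIV = measure \<mu> UNIV"
  by (simp add: measure_distr)

definition char_fun :: "'a \<Rightarrow> 'a \<Rightarrow> complex" where
  "char_fun \<xi> \<eta> = (\<integral>x. cis (\<xi> \<bullet> fst x + \<eta> \<bullet> snd x) \<partial>\<mu>)"

lemma char_fun_orthogonal:
  assumes g: "orthogonal_transformation g"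
  shows "char_fun (g \<xi>) (g \<eta>) = char_fun \<xi> \<eta>"
proof -
  have "char_fun (g \<xi>) (g \<eta>) = (\<integral>x. cis (g \<xi> \<bullet> g (fst x) + g \<eta> \<bullet> g (snd x)) \<partial>\<mu>)"
    unfolding char_fun_def using integral_mu_orthogonal[OF g, of "\<lambda>x. cis (g \<xi> \<bullet> fst x + g \<eta> \<bullet> snd x)"] by simp
  then show ?thesis
    using g by (simp add: orthogonal_transformation_def char_fun_def)
qed

lemma norm_char_fun_le: "norm (char_fun \<xi> \<eta>) \<le> measure \<mu> UNIV"
proof -
  have "norm (char_fun \<xi> \<eta>) \<le> 1 * measure \<mu> (space \<mu>)"
    unfolding char_fun_def by (rule norm_integral_le_const[OF finite_measure_axioms]) simp_all
  then show ?thesis by simp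
qed

text \<open>Averaging over the positions of \<open>p\<close> on its sphere in the hyperplane orthogonal to \<open>n\<close>, which does not
  change the left-hand side.\<close>

lemma char_fun_average:
  assumes n: "norm n = 1" and p: "p \<bullet> n = 0"
  shows "(\<integral>z. sin2 n z \<partial>\<nu>) * char_fun (\<alpha> *\<^sub>R n + p) (\<gamma> *\<^sub>R n) =
    (\<integral>x. cis (\<alpha> * (n \<bullet> fst x) + \<gamma> * (n \<bullet> snd x)) * nu.G n (norm p *\<^sub>R perp n (fst x)) \<partial>\<mu>)"
proof -
  define F where "F x z = sin2 n z * cis ((\<alpha> *\<^sub>R n + norm p *\<^sub>R perp_dir n z) \<bullet> fst x + (\<gamma> *\<^sub>R n) \<bullet> snd x)" for x z
  have F[measurable]: "(\<lambda>(x, z). F x z) \<in> borel_measurable (\<mu> \<Otimes>\<^sub>M \<nu>)"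
    unfolding F_def by measurable
  have "(\<integral>z. sin2 n z \<partial>\<nu>) * char_fun (\<alpha> *\<^sub>R n + p) (\<gamma> *\<^sub>R n) = (\<integral>z. sin2 n z * char_fun (\<alpha> *\<^sub>R n + p) (\<gamma> *\<^sub>R n) \<partial>\<nu>)"
    by (simp flip: integral_complex_of_real)
  also have "\<dots> = (\<integral>z. (\<integral>x. F x z \<partial>\<mu>) \<partial>\<nu>)"
  proof (rule integral_cong_AE)
    show "AE z in \<nu>. sin2 n z * char_fun (\<alpha> *\<^sub>R n + p) (\<gamma> *\<^sub>R n) = (\<integral>x. F x z \<partial>\<mu>)"
      using nu.unit_nu
    proof eventually_elim
      case (elim z)
      show ?case
      proof (cases "perp n z = 0")
        case True
        then have "sin2 n z = 0"
          using norm_perp_sin2[OF n elim] by simp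
        then show ?thesis by (simp add: F_def)
      next
        case False
        then have "norm p = norm (norm p *\<^sub>R perp_dir n z)"
          by (simp add: norm_perp_dir)
        then obtain g where g: "orthogonal_transformation g" "g p = norm p *\<^sub>R perp_dir n z"
            "\<And>x. x \<bullet> p = x \<bullet> (norm p *\<^sub>R perp_dir n z) \<Longrightarrow> g x = x"
          using reflection_exists by metis
        \<comment> \<open>\<open>p\<close> and its image are both orthogonal to \<open>n\<close>, so
          the reflection moves the direction of \<open>p\<close> alone and leaves the components
          along \<open>n\<close> in place.\<close>
        have gn: "g n = n"
          using p inner_perp(2)[OF n, of z] by (intro g(3)) (simp add: inner_commute)
        have lin: "linear g"
          using g(1) by (rule orthogonal_transformation_linear)
        have "char_fun (\<alpha> *\<^sub>R n + p) (\<gamma> *\<^sub>R n) = char_fun (g (\<alpha> *\<^sub>R n + p)) (g (\<gamma> *\<^sub>R n))"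
          using char_fun_orthogonal[OF g(1)] by simp
        also have "\<dots> = char_fun (\<alpha> *\<^sub>R n + norm p *\<^sub>R perp_dir n z) (\<gamma> *\<^sub>R n)"
          by (simp add: linear_add[OF lin] linear_scale[OF lin] gn g(2))
        finally show ?thesis
          by (simp add: F_def char_fun_def)
      qed
    qed
    have "(\<lambda>z. \<integral>x. F x z \<partial>\<mu>) \<in> borel_measurable \<nu>"
      unfolding F_def by measurable
    then show "(\<lambda>z. \<integral>x. F x z \<partial>\<mu>) \<in> borel_measurable \<nu>" .
  qed measurable
  also have "\<dots> = (\<integral>x. (\<integral>z. F x z \<partial>\<nu>) \<partial>\<mu>)"
    by (rule integral_swap_bounded[where C=1, OF finite_measure_axioms nu.finite_measure_axioms F])
      (simp add: F_def norm_mult sin2_bounds)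
  also have "\<dots> = (\<integral>x. cis (\<alpha> * (n \<bullet> fst x) + \<gamma> * (n \<bullet> snd x)) * nu.G n (norm p *\<^sub>R perp n (fst x)) \<partial>\<mu>)"
  proof (rule Bochner_Integration.integral_cong)
    fix x :: "'a \<times> 'a"
    have "F x z = cis (\<alpha> * (n \<bullet> fst x) + \<gamma> * (n \<bullet> snd x)) *
       (sin2 n z * cis ((norm p *\<^sub>R perp n (fst x)) \<bullet> perp_dir n z))" for z
      using inner_perp_dir[OF n, of z "fst x"]
      by (simp add: F_def inner_simps algebra_simps flip: cis_mult)
    then show "(\<integral>z. F x z \<partial>\<nu>) = cis (\<alpha> * (n \<bullet> fst x) + \<gamma> * (n \<bullet> snd x)) * nu.G n (norm p *\<^sub>R perp n (fst x))"
      unfolding nu.G_def by simp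
  qed simp
  finally show ?thesis .
qed

end

context invariant_triangle_measure
begin

text \<open>The factors on the left record three averages: m from the axis \<open>n\<close>, and m
  (1 - 1/d), the integral of \<open>sin2\<close>, once from the direction of \<open>p\<close> and
  once from the part of v orthogonal to u. The number sqrt 3 / 2 is the length of that part, the
  height of the triangle.\<close>

lemma char_fun_le_axis:
  fixes n p :: 'a and \<alpha> \<gamma> :: real
  defines "N \<equiv> (real DIM('a) - 2) / 2" and "m \<equiv> measure \<mu> UNIV"
  defines "c \<equiv> sqrt 3 / 2 * \<gamma>"
  assumes n: "norm n = 1" and p: "p \<bullet> n = 0" and \<gamma>: "\<gamma> \<ge> 0"
  shows "m * (m * (1 - 1 / DIM('a)))\<^sup>2 * norm (char_fun (\<alpha> *\<^sub>R n + p) (\<gamma> *\<^sub>R n)) \<le>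
    m * ((nu.decay_const * m)\<^sup>2 * 2 powr N * (4 * 4 powr N * m) * (1 + c + norm p * c) powr (- N))"
proof -
  define \<beta> where "\<beta> = norm p"
  define c0 where "c0 = m * (1 - 1 / DIM('a))"
  have c00: "c0 \<ge> 0" using dim2 by (simp add: c0_def m_def)
  have sin2_eq: "(\<integral>z. sin2 e z \<partial>\<nu>) = c0" if "norm e = 1" for e
    using nu.integral_sin2[OF that] by (simp add: c0_def m_def measure_nu)
  define f where "f z u = cis (\<alpha> * (z \<bullet> u)) * nu.G z (\<beta> *\<^sub>R perp z u)" for z u
  have f_meas [measurable]: "(\<lambda>x. f (g x) (h x)) \<in> borel_measurable M"
    if [measurable]: "g \<in> borel_measurable M" "h \<in> borel_measurable M" for g h and M :: "'x measure"
    unfolding f_def by measurable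
  have f_le: "norm (f z u) \<le> m" for z u
    using nu.norm_G_le by (simp add: f_def norm_mult m_def measure_nu)
  have f_orth: "f (g z) (g u) = f z u" if g: "orthogonal_transformation g" for g z u
  proof -
    have "g z \<bullet> g u = z \<bullet> u" using g by (simp add: orthogonal_transformation_def)
    moreover have "nu.G (g z) (\<beta> *\<^sub>R perp (g z) (g u)) = nu.G z (\<beta> *\<^sub>R perp z u)"
      using nu.G_orthogonal[OF g, of z "\<beta> *\<^sub>R perp z u"]
      by (simp add: orthogonal_transformation_perp[OF g] orthogonal_transformation_scaleR[OF g])
    ultimately show ?thesis by (simp add: f_def)
  qed
  define L where "L e = (\<integral>x. cis (\<gamma> * (e \<bullet> snd x)) * f e (fst x) \<partial>\<mu>)" for e
  have L: "c0 * char_fun (\<alpha> *\<^sub>R n + p) (\<gamma> *\<^sub>R n) = L n"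
    using char_fun_average[OF n p, of \<alpha> \<gamma>] unfolding sin2_eq[OF n]
    by (simp add: L_def f_def \<beta>_def mult_ac flip: cis_mult)
  \<comment> \<open>Rotating the whole triangle moves one axis to another. Hence the axis may be
    replaced by a variable \<open>z\<close> with law \<nu>, at the cost of the factor m.\<close>
  have L_const: "L e = L n" if e: "norm e = 1" for e
  proof -
    obtain g where g: "orthogonal_transformation g" "g e = n"
      using reflection_exists[of e n] e n by metis
    note [measurable] = borel_measurable_orthogonal_transformation[OF g(1)]
    have "L n = (\<integral>x. cis (\<gamma> * (n \<bullet> g (snd x))) * f n (g (fst x)) \<partial>\<mu>)"
      unfolding L_def
      using integral_mu_orthogonal[OF g(1), of "\<lambda>x. cis (\<gamma> * (n \<bullet> snd x)) * f n (fst x)"] by simp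
    also have "\<dots> = L e"
      using g f_orth[OF g(1), of e] by (auto simp: L_def orthogonal_transformation_def simp flip: g(2))
    finally show ?thesis by simp
  qed
  define K where "K x = (\<integral>z. cis (\<gamma> * (z \<bullet> snd x)) * f z (fst x) \<partial>\<nu>)" for x
  have [measurable]: "K \<in> borel_measurable borel"
    unfolding K_def by measurable
  have "m * L n = (\<integral>z. L n \<partial>\<nu>)"
    by (simp add: m_def measure_nu scaleR_conv_of_real)
  also have "\<dots> = (\<integral>z. L z \<partial>\<nu>)"
  proof (rule integral_cong_AE)
    show "AE z in \<nu>. L n = L z"
      using nu.unit_nu by eventually_elim (simp add: L_const)
    show "L \<in> borel_measurable \<nu>"
      unfolding L_def by measurable
  qed measurable
  also have "\<dots> = (\<integral>x. K x \<partial>\<mu>)"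
    unfolding L_def K_def
    by (rule integral_swap_bounded[where C=m, OF finite_measure_axioms nu.finite_measure_axioms])
      (use f_le in \<open>auto simp: norm_mult\<close>)
  finally have mL: "m * L n = (\<integral>x. K x \<partial>\<mu>)" .
  define R where "R = (nu.decay_const * m)\<^sup>2 * 2 powr N * (4 * 4 powr N * m) * (1 + c + \<beta> * c) powr (- N)"
  have c: "c \<ge> 0" using \<gamma> by (simp add: c_def)
  have \<beta>: "\<beta> \<ge> 0" by (simp add: \<beta>_def)
  \<comment> \<open>This holds for each single triangle. Splitting v into u / 2 and \<open>y\<close>
    orthogonal to u, \<open>y\<close> is turned about u to the direction of a second variable
    \<open>z'\<close>; integrating over \<open>z'\<close> first turns the phase of \<open>y\<close>
    into a factor \<open>nu.G u\<close>.\<close>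
  have K_le: "AE x in \<mu>. c0 * norm (K x) \<le> R"
    using tri_mu
  proof eventually_elim
    case (elim x)
    define u where "u = fst x"
    define y where "y = snd x - (1/2) *\<^sub>R u"
    have u: "norm u = 1" using elim by (simp add: u_def)
    have uv: "u \<bullet> snd x = 1/2"
    proof -
      have "(norm (fst x - snd x))\<^sup>2 = (norm (fst x))\<^sup>2 + (norm (snd x))\<^sup>2 - 2 * (fst x \<bullet> snd x)"
        by (simp add: power2_norm_eq_inner inner_simps inner_commute)
      then show ?thesis using elim by (simp add: u_def)
    qed
    have yu: "y \<bullet> u = 0"
      using uv u by (simp add: y_def inner_simps inner_commute norm_eq_1)
    have normy: "norm y = sqrt 3 / 2"
    proof -
      have "(norm y)\<^sup>2 = (norm (snd x))\<^sup>2 - (u \<bullet> snd x) + (1/4) * (norm u)\<^sup>2"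
        unfolding y_def power2_norm_eq_inner by (simp add: inner_simps inner_commute)
      also have "\<dots> = (sqrt 3 / 2)\<^sup>2"
        using elim u uv by (simp add: power_divide)
      finally show ?thesis
        by (simp add: power2_eq_iff_nonneg)
    qed
    define H where "H q = (\<integral>z. cis (\<gamma> * (z \<bullet> u) / 2) * f z u * cis (\<gamma> * (z \<bullet> q)) \<partial>\<nu>)" for q
    have H_meas [measurable]: "(\<lambda>z. H (h z)) \<in> borel_measurable M" if [measurable]: "h \<in> borel_measurable M" for h and M :: "'x measure"
      unfolding H_def by measurable
    have KH: "K x = H y"
    proof -
      have "cis (\<gamma> * (z \<bullet> snd x)) = cis (\<gamma> * (z \<bullet> u) / 2) * cis (\<gamma> * (z \<bullet> y))" for z
        by (simp add: cis_mult y_def inner_simps right_diff_distrib)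
      then show ?thesis
        by (simp add: K_def H_def u_def mult_ac)
    qed
    define F where "F z z' = sin2 u z' * (cis (\<gamma> * (z \<bullet> u) / 2) * f z u * cis (\<gamma> * (z \<bullet> ((sqrt 3 / 2) *\<^sub>R perp_dir u z'))))" for z z'
    have F[measurable]: "(\<lambda>(z, z'). F z z') \<in> borel_measurable (\<nu> \<Otimes>\<^sub>M \<nu>)"
      unfolding F_def by measurable
    have "c0 * K x = (\<integral>z'. sin2 u z' * H y \<partial>\<nu>)"
      unfolding KH sin2_eq[OF u, symmetric] by (simp flip: integral_complex_of_real)
    also have "\<dots> = (\<integral>z'. (\<integral>z. F z z' \<partial>\<nu>) \<partial>\<nu>)"
    proof (rule integral_cong_AE)
      show "AE z' in \<nu>. sin2 u z' * H y = (\<integral>z. F z z' \<partial>\<nu>)"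
        using nu.unit_nu
      proof eventually_elim
        case (elim z')
        show ?case
        proof (cases "perp u z' = 0")
          case True
          then have "sin2 u z' = 0"
            using norm_perp_sin2[OF u elim] by simp
          then show ?thesis by (simp add: F_def)
        next
          case False
          define q where "q = (sqrt 3 / 2) *\<^sub>R perp_dir u z'"
          have "norm y = norm q"
            using False by (simp add: q_def norm_perp_dir normy)
          then obtain g where g: "orthogonal_transformation g" "g y = q" "\<And>x. x \<bullet> y = x \<bullet> q \<Longrightarrow> g x = x"
            using reflection_exists by metis
          have gu: "g u = u"
            using yu inner_perp(2)[OF u, of z'] by (intro g(3)) (simp add: inner_commute q_def)
          note [measurable] = borel_measurable_orthogonal_transformation[OF g(1)]
          have "H q = (\<integral>z. cis (\<gamma> * (g z \<bullet> u) / 2) * f (g z) u * cis (\<gamma> * (g z \<bullet> q)) \<partial>\<nu>)"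
            unfolding H_def
            by (rule nu.integral_nu_orthogonal[OF g(1), symmetric]) measurable
          \<comment> \<open>The reflection fixes u, and \<open>f\<close> is invariant when both of
            its arguments are moved; so turning \<open>y\<close> is the same as turning the
            integration variable, under which \<nu> is invariant.\<close>
          also have "\<dots> = H y"
          proof -
            have "g z \<bullet> u = z \<bullet> u" "g z \<bullet> q = z \<bullet> y" "f (g z) u = f z u" for z
              using g(1) gu g(2) f_orth[OF g(1), of z u] by (auto simp: orthogonal_transformation_def) metis+
            then show ?thesis by (simp add: H_def)
          qed
          finally show ?thesis
            by (simp add: F_def q_def H_def)
        qed
      qed
      show "(\<lambda>z'. \<integral>z. F z z' \<partial>\<nu>) \<in> borel_measurable \<nu>"
        unfolding F_def by measurable
    qed measurable
    also have "\<dots> = (\<integral>z. (\<integral>z'. F z z' \<partial>\<nu>) \<partial>\<nu>)"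
      by (rule integral_swap_bounded[where C=m, OF nu.finite_measure_axioms nu.finite_measure_axioms F])
        (auto simp: F_def norm_mult intro!: mult_left_le_one_le[THEN order_trans] sin2_bounds f_le)
    also have "\<dots> = (\<integral>z. cis (\<gamma> * (z \<bullet> u) / 2) * f z u * nu.G u (c *\<^sub>R perp u z) \<partial>\<nu>)"
    proof (rule Bochner_Integration.integral_cong)
      fix z :: 'a
      have "F z z' = cis (\<gamma> * (z \<bullet> u) / 2) * f z u * (sin2 u z' * cis ((c *\<^sub>R perp u z) \<bullet> perp_dir u z'))" for z'
        using inner_perp_dir[OF u, of z' z]
        by (simp add: F_def c_def inner_simps inner_commute[of z] mult_ac)
      then show "(\<integral>z'. F z z' \<partial>\<nu>) = cis (\<gamma> * (z \<bullet> u) / 2) * f z u * nu.G u (c *\<^sub>R perp u z)"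
        unfolding nu.G_def by simp
    qed simp
    finally have "norm (c0 * K x) \<le> (\<integral>z. norm (cis (\<gamma> * (z \<bullet> u) / 2) * f z u * nu.G u (c *\<^sub>R perp u z)) \<partial>\<nu>)"
      by (simp only: integral_norm_bound)
    also have "\<dots> = (\<integral>z. norm (nu.G z (\<beta> *\<^sub>R perp z u)) * norm (nu.G u (c *\<^sub>R perp u z)) \<partial>\<nu>)"
      by (simp add: norm_mult f_def)
    also have "\<dots> \<le> R"
      using nu.integral_G_G_le[OF u \<beta> c] by (simp add: R_def N_def m_def measure_nu)
    finally show "c0 * norm (K x) \<le> R"
      using c00 by (simp add: norm_mult)
  qed
  have "norm (m * L n) * c0 \<le> (\<integral>x. norm (K x) \<partial>\<mu>) * c0"
    unfolding mL using c00 by (intro mult_right_mono integral_norm_bound) auto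
  also have "\<dots> = (\<integral>x. c0 * norm (K x) \<partial>\<mu>)"
    by simp
  also have "\<dots> \<le> (\<integral>x. R \<partial>\<mu>)"
  proof (rule integral_mono_AE)
    show "integrable \<mu> (\<lambda>x. c0 * norm (K x))"
      using K_le c00 by (intro integrable_const_bound[where B=R]) auto
  qed (use K_le in auto)
  also have "\<dots> = m * R"
    by (simp add: m_def)
  finally have "norm (m * L n) * c0 \<le> m * R" .
  moreover have "norm (m * L n) * c0 = m * c0\<^sup>2 * norm (char_fun (\<alpha> *\<^sub>R n + p) (\<gamma> *\<^sub>R n))"
    unfolding L[symmetric] using c00 by (simp add: norm_mult power2_eq_square m_def)
  ultimately have "m * c0\<^sup>2 * norm (char_fun (\<alpha> *\<^sub>R n + p) (\<gamma> *\<^sub>R n)) \<le> m * R"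
    by (simp only:)
  then show ?thesis
    by (simp only: R_def c0_def \<beta>_def)
qed

end

text \<open>The area of the parallelogram spanned by the two vectors. As the norm of a vector linear
  in \<xi> it satisfies the triangle inequality in \<xi>; the symmetry appears in its square. For
  \<eta> = 0 the value is 0.\<close>

definition area :: "'a::real_inner \<Rightarrow> 'a \<Rightarrow> real" where
  "area \<xi> \<eta> = norm (norm \<eta> *\<^sub>R \<xi> - ((\<xi> \<bullet> \<eta>) / norm \<eta>) *\<^sub>R \<eta>)"

lemma area_squared: "(area \<xi> \<eta>)\<^sup>2 = (norm \<xi>)\<^sup>2 * (norm \<eta>)\<^sup>2 - (\<xi> \<bullet> \<eta>)\<^sup>2"
proof (cases "\<eta> = 0")
  case False
  define v where "v = norm \<eta> *\<^sub>R \<xi> - ((\<xi> \<bullet> \<eta>) / norm \<eta>) *\<^sub>R \<eta>"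
  have "(area \<xi> \<eta>)\<^sup>2 = v \<bullet> v"
    by (simp add: area_def v_def dot_square_norm)
  also have "\<dots> = (norm \<eta>)\<^sup>2 * (\<xi> \<bullet> \<xi>) - 2 * (\<xi> \<bullet> \<eta>)\<^sup>2 + ((\<xi> \<bullet> \<eta>) / norm \<eta>)\<^sup>2 * (\<eta> \<bullet> \<eta>)"
    using False by (simp add: v_def inner_simps inner_commute power2_eq_square)
  finally show ?thesis
    using False by (simp add: power_divide dot_square_norm)
qed (simp add: area_def)

lemma area_nonneg: "area \<xi> \<eta> \<ge> 0"
  by (simp add: area_def)

lemma area_commute: "area \<xi> \<eta> = area \<eta> \<xi>"
  using area_squared[of \<xi> \<eta>] area_squared[of \<eta> \<xi>] area_nonneg
  by (metis inner_commute mult.commute power2_eq_iff_nonneg)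

lemma area_le: "area \<xi> \<eta> \<le> norm \<xi> * norm \<eta>"
  by (rule power2_le_imp_le) (simp_all add: area_squared power_mult_distrib)

lemma area_triangle_left: "area (\<xi> + \<delta>) \<eta> \<le> area \<xi> \<eta> + area \<delta> \<eta>"
proof -
  have "norm \<eta> *\<^sub>R (\<xi> + \<delta>) - (((\<xi> + \<delta>) \<bullet> \<eta>) / norm \<eta>) *\<^sub>R \<eta> =
    (norm \<eta> *\<^sub>R \<xi> - ((\<xi> \<bullet> \<eta>) / norm \<eta>) *\<^sub>R \<eta>) + (norm \<eta> *\<^sub>R \<delta> - ((\<delta> \<bullet> \<eta>) / norm \<eta>) *\<^sub>R \<eta>)"
    by (simp add: inner_simps algebra_simps add_divide_distrib)
  then show ?thesis
    unfolding area_def by (simp only: norm_triangle_ineq)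
qed

section \<open>Decay in both frequencies\<close>

context invariant_triangle_measure
begin

lemma char_fun_decay_half:
  obtains C where "C \<ge> 0"
    "\<And>\<xi> \<eta>. norm (char_fun \<xi> \<eta>) \<le> C * (1 + norm \<eta> + area \<xi> \<eta>) powr (- ((real DIM('a) - 2) / 2))"
proof -
  define N where "N = (real DIM('a) - 2) / 2"
  define m where "m = measure \<mu> UNIV"
  define c0 where "c0 = m * (m * (1 - 1 / DIM('a)))\<^sup>2"
  define A where "A = m * ((nu.decay_const * m)\<^sup>2 * 2 powr N * (4 * 4 powr N * m))"
  define \<kappa> :: real where "\<kappa> = sqrt 3 / 2"
  have \<kappa>: "0 < \<kappa>" "\<kappa> \<le> 1"
    using real_sqrt_le_mono[of 3 4] by (simp_all add: \<kappa>_def)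
  have N0: "N \<ge> 0" using dim2 by (simp add: N_def)
  have m0: "m \<ge> 0" by (simp add: m_def)
  have A0: "A \<ge> 0" using m0 by (simp add: A_def)
  \<comment> \<open>The summand \<open>m\<close> serves \<eta> = 0, where there is no axis and the
    decay factor is 1. If m = 0 then c0 = 0 as well, and the quotient is 0 by convention.\<close>
  define C where "C = m + (A / c0) * \<kappa> powr (- N)"
  have c0: "c0 \<ge> 0" using m0 by (simp add: c0_def)
  show thesis
  proof (rule that[of C])
    show "C \<ge> 0" using m0 A0 c0 by (simp add: C_def)
    fix \<xi> \<eta> :: 'a
    have "norm (char_fun \<xi> \<eta>) \<le> C * (1 + norm \<eta> + area \<xi> \<eta>) powr (- N)"
    proof (cases "m = 0 \<or> \<eta> = 0")
      case True
      have m: "norm (char_fun \<xi> \<eta>) \<le> m"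
        using norm_char_fun_le by (simp add: m_def)
      show ?thesis
      proof (cases "m = 0")
        case True
        then show ?thesis using m \<open>C \<ge> 0\<close> by (auto intro: order_trans[OF m])
      next
        case False
        with \<open>m = 0 \<or> \<eta> = 0\<close> have "\<eta> = 0" by simp
        moreover have "m \<le> C" using A0 c0 by (simp add: C_def)
        ultimately show ?thesis using m by (simp add: area_def)
      qed
    next
      case False
      then have m: "m > 0" and \<eta>: "\<eta> \<noteq> 0" using m0 by auto
      have c0: "c0 > 0" using m dim2 by (auto simp: c0_def)
      define \<gamma> where "\<gamma> = norm \<eta>"
      define n where "n = \<eta> /\<^sub>R \<gamma>"
      have n: "norm n = 1" and \<gamma>: "\<gamma> > 0" and \<eta>_eq: "\<eta> = \<gamma> *\<^sub>R n"
        using \<eta> by (auto simp: n_def \<gamma>_def)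
      have p: "perp n \<xi> \<bullet> n = 0" by (rule inner_perp(1)[OF n])
      have \<xi>_eq: "\<xi> = (\<xi> \<bullet> n) *\<^sub>R n + perp n \<xi>" by (simp add: perp_def)
      have area: "area \<xi> \<eta> = norm (perp n \<xi>) * \<gamma>"
      proof -
        have "norm \<eta> *\<^sub>R \<xi> - ((\<xi> \<bullet> \<eta>) / norm \<eta>) *\<^sub>R \<eta> = \<gamma> *\<^sub>R perp n \<xi>"
          using \<gamma> n by (simp add: perp_def \<eta>_eq algebra_simps)
        then show ?thesis using \<gamma> by (simp add: area_def mult.commute)
      qed
      define c where "c = \<kappa> * \<gamma>"
      have le: "\<kappa> * (1 + \<gamma> + norm (perp n \<xi>) * \<gamma>) \<le> 1 + c + norm (perp n \<xi>) * c"
        using \<kappa> by (simp add: c_def algebra_simps)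
      have "c0 * norm (char_fun ((\<xi> \<bullet> n) *\<^sub>R n + perp n \<xi>) (\<gamma> *\<^sub>R n)) \<le> A * (1 + c + norm (perp n \<xi>) * c) powr (- N)"
        using char_fun_le_axis[OF n p, of \<gamma> "\<xi> \<bullet> n"] \<gamma>
        by (simp add: A_def c0_def N_def m_def c_def \<kappa>_def mult.assoc)
      then have "c0 * norm (char_fun \<xi> \<eta>) \<le> A * (1 + c + norm (perp n \<xi>) * c) powr (- N)"
        by (simp flip: \<xi>_eq \<eta>_eq)
      also have "\<dots> \<le> A * (\<kappa> * (1 + \<gamma> + norm (perp n \<xi>) * \<gamma>)) powr (- N)"
        using \<kappa> \<gamma> N0 A0 by (intro mult_left_mono powr_mono2'[OF _ _ le] mult_pos_pos add_pos_nonneg) auto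
      also have "\<dots> = A * (\<kappa> powr (- N) * (1 + \<gamma> + norm (perp n \<xi>) * \<gamma>) powr (- N))"
        using \<kappa> \<gamma> by (simp add: powr_mult)
      finally have "norm (char_fun \<xi> \<eta>) \<le> (A / c0) * \<kappa> powr (- N) * (1 + \<gamma> + norm (perp n \<xi>) * \<gamma>) powr (- N)"
        using c0 by (simp add: field_simps)
      also have "\<dots> \<le> C * (1 + \<gamma> + norm (perp n \<xi>) * \<gamma>) powr (- N)"
        using m0 by (intro mult_right_mono) (auto simp: C_def)
      finally show ?thesis by (simp add: area \<gamma>_def)
    qed
    then show "norm (char_fun \<xi> \<eta>) \<le> C * (1 + norm \<eta> + area \<xi> \<eta>) powr (- ((real DIM('a) - 2) / 2))"
      by (simp add: N_def)
  qed
qed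

theorem char_fun_decay:
  assumes swap: "distr \<mu> borel prod.swap = \<mu>"
  obtains C where "C \<ge> 0"
    "\<And>\<xi> \<eta>. norm (char_fun \<xi> \<eta>) \<le> C * (1 + norm \<xi> + norm \<eta> + area \<xi> \<eta>) powr (- ((real DIM('a) - 2) / 2))"
proof -
  define N where "N = (real DIM('a) - 2) / 2"
  have N0: "N \<ge> 0" using dim2 by (simp add: N_def)
  obtain C where C: "C \<ge> 0" "\<And>\<xi> \<eta>. norm (char_fun \<xi> \<eta>) \<le> C * (1 + norm \<eta> + area \<xi> \<eta>) powr (- N)"
    using char_fun_decay_half unfolding N_def by metis
  have comm: "char_fun \<xi> \<eta> = char_fun \<eta> \<xi>" for \<xi> \<eta>
  proof -
    have [measurable]: "prod.swap \<in> borel_measurable (borel :: ('a \<times> 'a) measure)"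
      unfolding prod.swap_def by measurable
    have "char_fun \<xi> \<eta> = (\<integral>x. cis (\<xi> \<bullet> fst x + \<eta> \<bullet> snd x) \<partial>distr \<mu> borel prod.swap)"
      by (simp add: char_fun_def swap)
    also have "\<dots> = char_fun \<eta> \<xi>"
      by (subst integral_distr) (auto simp: char_fun_def add.commute)
    finally show ?thesis .
  qed
  \<comment> \<open>The bound of \<open>char_fun_decay_half\<close> lacks |\<xi>|. If |\<xi>| <=
    |\<eta>|, its base is at least half of the symmetric one; the other case follows by exchanging
    the vectors.\<close>
  have wlog: "norm (char_fun \<xi> \<eta>) \<le> C * 2 powr N * (1 + norm \<xi> + norm \<eta> + area \<xi> \<eta>) powr (- N)"
    if "norm \<xi> \<le> norm \<eta>" for \<xi> \<eta>
  proof -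
    have "norm (char_fun \<xi> \<eta>) \<le> C * (1 + norm \<eta> + area \<xi> \<eta>) powr (- N)"
      by (rule C(2))
    also have "\<dots> \<le> C * ((1 + norm \<xi> + norm \<eta> + area \<xi> \<eta>) / 2) powr (- N)"
      using that C(1) N0 area_nonneg[of \<xi> \<eta>] by (intro mult_left_mono powr_mono2') (auto intro!: add_pos_nonneg)
    also have "\<dots> = C * 2 powr N * (1 + norm \<xi> + norm \<eta> + area \<xi> \<eta>) powr (- N)"
      using area_nonneg[of \<xi> \<eta>] by (simp add: powr_divide powr_minus field_simps)
    finally show ?thesis .
  qed
  show thesis
  proof (rule that[of "C * 2 powr N"])
    show "norm (char_fun \<xi> \<eta>) \<le> C * 2 powr N * (1 + norm \<xi> + norm \<eta> + area \<xi> \<eta>) powr (- ((real DIM('a) - 2) / 2))" for \<xi> \<eta>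
      using wlog[of \<xi> \<eta>] wlog[of \<eta> \<xi>] comm[of \<xi> \<eta>] area_commute[of \<xi> \<eta>]
      by (cases "norm \<xi> \<le> norm \<eta>") (auto simp: N_def add_ac)
  qed (use C in auto)
qed

end

section \<open>Bounds for the derivatives\<close>

lemma has_vector_derivative_cis_affine:
  "((\<lambda>t. cis (p + q * t)) has_vector_derivative \<i> * q * cis (p + q * t)) (at t)"
proof -
  have "((\<lambda>z. exp (\<i> * (of_real p + of_real q * z))) has_field_derivative
      \<i> * of_real q * exp (\<i> * (of_real p + of_real q * of_real t))) (at (of_real t))"
    by (auto intro!: derivative_eq_intros)
  from has_vector_derivative_real_field[OF this] show ?thesis
    by (simp add: cis_conv_exp)
qed

lemma char_std_normal_cis:
  "(\<integral>s. cis (s * t) \<partial>std_normal_distribution) = of_real (exp (- t\<^sup>2 / 2))"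
  using fun_cong[OF char_std_normal_distribution, of t]
  by (simp add: char_def cis_conv_exp mult.commute)

interpretation std_normal: prob_space std_normal_distribution
  by (rule prob_space_normal_density) simp

lemma integrable_std_normal_pow: "integrable std_normal_distribution (\<lambda>s. (1 + \<bar>s\<bar>) ^ k)"
proof (rule Bochner_Integration.integrable_bound)
  show "integrable std_normal_distribution (\<lambda>s. 2 ^ k * (2 + s ^ (2 * k)))"
    using integrable_std_normal_distribution_moment[of "2 * k"] by simp
  have "(1 + \<bar>s\<bar>) ^ k \<le> 2 ^ k * (2 + s ^ (2 * k))" for s :: real
  proof -
    have "(1 + \<bar>s\<bar>) ^ k \<le> (2 * max 1 \<bar>s\<bar>) ^ k"
      by (intro power_mono) auto
    also have "\<dots> = 2 ^ k * max 1 \<bar>s\<bar> ^ k"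
      by (simp add: power_mult_distrib)
    also have "max 1 \<bar>s\<bar> ^ k \<le> 2 + s ^ (2 * k)"
    proof (cases "\<bar>s\<bar> \<le> 1")
      case False
      then have "\<bar>s\<bar> ^ k \<le> \<bar>s\<bar> ^ (2 * k)"
        by (intro power_increasing) auto
      then show ?thesis using False by (simp add: power_mult)
    qed (simp add: power_mult)
    finally show ?thesis by simp
  qed
  then show "AE s in std_normal_distribution. norm ((1 + \<bar>s\<bar>) ^ k) \<le> norm (2 ^ k * (2 + s ^ (2 * k)))"
    by (auto simp: abs_mult power_mult)
qed simp

text \<open>The derivative of the characteristic function exp (- t^2 / 2), taken under the integral
  sign. It represents a coordinate times a Gaussian as a Fourier transform with the linearly growing
  factor - \<i> s.\<close>

lemma integral_std_normal_times_cis: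
  "(\<integral>s. - \<i> * s * cis (s * t) \<partial>std_normal_distribution) = of_real (t * exp (- t\<^sup>2 / 2))"
proof -
  have "((\<lambda>t. \<integral>s. cis (s * t) \<partial>std_normal_distribution) has_vector_derivative
      (\<integral>s. \<i> * s * cis (s * t) \<partial>std_normal_distribution)) (at t)"
  proof (rule has_vector_derivative_integral[where w="\<lambda>s. \<bar>s\<bar>" and f'="\<lambda>t s. \<i> * s * cis (s * t)"])
    show "integrable std_normal_distribution (\<lambda>s. cis (s * t))" for t
      by (rule std_normal.integrable_const_bound[where B=1]) auto
    show "AE s in std_normal_distribution. \<forall>t. ((\<lambda>t. cis (s * t)) has_vector_derivative \<i> * s * cis (s * t)) (at t)"
      using has_vector_derivative_cis_affine[of 0] by auto
    show "integrable std_normal_distribution (\<lambda>s. \<bar>s\<bar>)"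
      by (rule Bochner_Integration.integrable_bound[OF integrable_std_normal_pow[of 1]]) auto
  qed (auto simp: norm_mult)
  then have "((\<lambda>t. of_real (exp (- t\<^sup>2 / 2)) :: complex) has_vector_derivative
      (\<integral>s. \<i> * s * cis (s * t) \<partial>std_normal_distribution)) (at t)"
    by (simp add: char_std_normal_cis)
  moreover have "((\<lambda>t. of_real (exp (- t\<^sup>2 / 2)) :: complex) has_vector_derivative of_real (- t * exp (- t\<^sup>2 / 2))) (at t)"
    by (rule has_vector_derivative_of_real)
      (auto intro!: derivative_eq_intros simp flip: has_real_derivative_iff_has_vector_derivative)
  ultimately have "(\<integral>s. \<i> * s * cis (s * t) \<partial>std_normal_distribution) = of_real (- t * exp (- t\<^sup>2 / 2))"
    by (rule vector_derivative_unique_at)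
  then show ?thesis by simp
qed

text \<open>The class of amplitudes \<open>a\<close> for which the Fourier transform of \<open>a \<mu>\<close> is bounded by \<open>D powr - N\<close> is
  stable under multiplication by coordinates: since \<open>S\<close> lies on a sphere, the Gaussian is constant on
  \<open>S\<close>, and a Gaussian times a coordinate is the Fourier transform of a rapidly decreasing function.\<close>

locale fourier_decay = finite_measure \<mu> for \<mu> :: "'e::euclidean_space measure" +
  fixes S :: "'e set" and R :: real and D :: "'e \<Rightarrow> real" and N :: real
  assumes sets_mu [simp, measurable_cong]: "sets \<mu> = sets borel"
    and S: "\<And>x. x \<in> S \<Longrightarrow> norm x = R"
    and D_pos: "\<And>\<zeta>. D \<zeta> > 0"
    and D_shift: "\<And>\<zeta> b s. b \<in> Basis \<Longrightarrow> D (\<zeta> + s *\<^sub>R b) \<le> (1 + \<bar>s\<bar>) * D \<zeta>"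
    and N: "N \<ge> 0"
begin

text \<open>Vanishing off \<open>S\<close> is required pointwise, so that bounds and identities
  valid on \<open>S\<close> hold for the functions themselves.\<close>

definition amplitude :: "('e \<Rightarrow> complex) \<Rightarrow> bool" where
  "amplitude a \<longleftrightarrow> a \<in> borel_measurable borel \<and> (\<exists>K. \<forall>x. norm (a x) \<le> K) \<and> (\<forall>x. x \<notin> S \<longrightarrow> a x = 0)"

definition ft :: "('e \<Rightarrow> complex) \<Rightarrow> 'e \<Rightarrow> complex" where
  "ft a \<zeta> = (\<integral>x. a x * cis (- (2 * pi * (\<zeta> \<bullet> x))) \<partial>\<mu>)"

definition decaying :: "('e \<Rightarrow> complex) \<Rightarrow> bool" where
  "decaying a \<longleftrightarrow> amplitude a \<and> (\<exists>C\<ge>0. \<forall>\<zeta>. norm (ft a \<zeta>) \<le> C * D \<zeta> powr (- N))"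

lemma amplitude_mult:
  assumes a: "amplitude a" and [measurable]: "h \<in> borel_measurable borel"
    and K: "\<And>x. x \<in> S \<Longrightarrow> norm (h x) \<le> K"
  shows "amplitude (\<lambda>x. a x * h x)"
proof -
  obtain L where L: "norm (a x) \<le> L" for x
    using a by (auto simp: amplitude_def)
  have [measurable]: "a \<in> borel_measurable borel"
    using a by (simp add: amplitude_def)
  have "norm (a x * h x) \<le> L * max 0 K" for x
  proof (cases "x \<in> S")
    case True
    then show ?thesis
      unfolding norm_mult using L[of x] K[of x] order_trans[OF norm_ge_zero L[of x]]
      by (intro mult_mono) auto
  next
    case False
    then have "a x = 0" using a by (simp add: amplitude_def)
    then show ?thesis using order_trans[OF norm_ge_zero L[of x]] by simp
  qed
  then show ?thesis
    using a by (auto simp: amplitude_def)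
qed

text \<open>Multiplying the amplitude by \<open>h (b \<bullet> x)\<close> replaces its transform by
  an average of the translates by - s / (2 pi) along \<open>b\<close>, with weight \<kappa> against
  the normal law. By \<open>D_shift\<close> each translate loses at most (1 + |s|) powr N, which is
  integrable together with \<kappa>.\<close>

lemma decaying_mult_fourier_transform:
  fixes \<kappa> :: "real \<Rightarrow> complex" and h :: "real \<Rightarrow> complex"
  assumes a: "decaying a" and b: "b \<in> Basis" and [measurable]: "\<kappa> \<in> borel_measurable borel"
    and \<kappa>: "\<And>s. norm (\<kappa> s) \<le> 1 + \<bar>s\<bar>"
    and h: "\<And>t. h t = (\<integral>s. \<kappa> s * cis (s * t) \<partial>std_normal_distribution)"
  shows "decaying (\<lambda>x. a x * h (b \<bullet> x))"
proof -
  let ?\<gamma> = "std_normal_distribution"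
  obtain C where C: "C \<ge> 0" "norm (ft a \<zeta>) \<le> C * D \<zeta> powr (- N)" for \<zeta>
    using a by (auto simp: decaying_def)
  have amp: "amplitude a" using a by (simp add: decaying_def)
  then obtain L where L: "norm (a x) \<le> L" for x
    by (auto simp: amplitude_def)
  have L0: "L \<ge> 0" using order_trans[OF norm_ge_zero L[of 0]] .
  have [measurable]: "a \<in> borel_measurable borel"
    using amp by (simp add: amplitude_def)
  have h_eq: "h = (\<lambda>t. \<integral>s. \<kappa> s * cis (s * t) \<partial>?\<gamma>)" using h by auto
  have [measurable]: "h \<in> borel_measurable borel"
    unfolding h_eq by measurable
  \<comment> \<open>A natural exponent, so that polynomial moments apply; \<open>Suc k\<close>
    accounts for the growth of \<kappa>.\<close>
  obtain k :: nat where k: "N \<le> real k" using real_arch_simple by blast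
  have int1: "integrable ?\<gamma> (\<lambda>s. (1 + \<bar>s\<bar>) ^ Suc j)" for j
    by (rule integrable_std_normal_pow)
  have int\<kappa>: "integrable ?\<gamma> \<kappa>"
    by (rule Bochner_Integration.integrable_bound[OF int1[of 0]]) (use \<kappa> in auto)
  have amp': "amplitude (\<lambda>x. a x * h (b \<bullet> x))"
  proof (rule amplitude_mult[OF amp])
    show "norm (h (b \<bullet> x)) \<le> (\<integral>s. norm (\<kappa> s) \<partial>?\<gamma>)" for x
      unfolding h by (rule order_trans[OF integral_norm_bound]) (simp add: norm_mult)
  qed measurable
  define F where "F \<zeta> s x = a x * (\<kappa> s * cis (s * (b \<bullet> x))) * cis (- (2 * pi * (\<zeta> \<bullet> x)))" for \<zeta> s x
  have F_le: "norm (F \<zeta> s x) \<le> L * norm (\<kappa> s)" for \<zeta> s x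
    using mult_right_mono[OF L[of x], of "norm (\<kappa> s)"] by (simp add: F_def norm_mult)
  have F_meas [measurable]: "(\<lambda>(s, x). F \<zeta> s x) \<in> borel_measurable (?\<gamma> \<Otimes>\<^sub>M \<mu>)" for \<zeta>
    unfolding F_def by measurable
  interpret P: pair_sigma_finite ?\<gamma> \<mu> ..
  have F_int: "integrable (?\<gamma> \<Otimes>\<^sub>M \<mu>) (\<lambda>(s, x). F \<zeta> s x)" for \<zeta>
  proof (rule P.Fubini_integrable)
    have 1: "norm (\<integral>x. norm (F \<zeta> s x) \<partial>\<mu>) \<le> L * norm (\<kappa> s) * measure \<mu> (space \<mu>)" for s
      by (rule norm_integral_le_const[OF finite_measure_axioms]) (use F_le L0 in auto)
    show "integrable ?\<gamma> (\<lambda>s. \<integral>x. norm (case (s, x) of (s, x) \<Rightarrow> F \<zeta> s x) \<partial>\<mu>)"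
    proof (rule Bochner_Integration.integrable_bound)
      show "integrable ?\<gamma> (\<lambda>s. L * norm (\<kappa> s) * measure \<mu> (space \<mu>))"
        using int\<kappa> by simp
      show "AE s in ?\<gamma>. norm (\<integral>x. norm (case (s, x) of (s, x) \<Rightarrow> F \<zeta> s x) \<partial>\<mu>) \<le> norm (L * norm (\<kappa> s) * measure \<mu> (space \<mu>))"
        using 1 L0 by (auto simp: abs_mult)
    qed measurable
    show "AE s in ?\<gamma>. integrable \<mu> (\<lambda>x. case (s, x) of (s, x) \<Rightarrow> F \<zeta> s x)"
    proof (rule always_eventually, rule allI)
      fix s
      have [measurable]: "(\<lambda>x. F \<zeta> s x) \<in> borel_measurable \<mu>"
        unfolding F_def by measurable
      show "integrable \<mu> (\<lambda>x. case (s, x) of (s, x) \<Rightarrow> F \<zeta> s x)"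
        by (rule integrable_const_bound[where B="L * norm (\<kappa> s)"]) (use F_le in auto)
    qed
  qed measurable
  define I where "I = (\<integral>s. (1 + \<bar>s\<bar>) ^ Suc k \<partial>?\<gamma>)"
  have "norm (ft (\<lambda>x. a x * h (b \<bullet> x)) \<zeta>) \<le> C * I * D \<zeta> powr (- N)" for \<zeta>
  proof -
    have "ft (\<lambda>x. a x * h (b \<bullet> x)) \<zeta> = (\<integral>x. (\<integral>s. F \<zeta> s x \<partial>?\<gamma>) \<partial>\<mu>)"
      unfolding ft_def h F_def by simp
    also have "\<dots> = (\<integral>s. (\<integral>x. F \<zeta> s x \<partial>\<mu>) \<partial>?\<gamma>)"
      by (rule P.Fubini_integral[OF F_int])
    also have "\<dots> = (\<integral>s. \<kappa> s * ft a (\<zeta> + (- s / (2 * pi)) *\<^sub>R b) \<partial>?\<gamma>)"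
    proof (rule Bochner_Integration.integral_cong)
      fix s
      have "F \<zeta> s x = \<kappa> s * (a x * cis (- (2 * pi * ((\<zeta> + (- s / (2 * pi)) *\<^sub>R b) \<bullet> x))))" for x
        by (simp add: F_def inner_simps cis_mult algebra_simps)
      then show "(\<integral>x. F \<zeta> s x \<partial>\<mu>) = \<kappa> s * ft a (\<zeta> + (- s / (2 * pi)) *\<^sub>R b)"
        by (simp add: ft_def)
    qed simp
    finally have "norm (ft (\<lambda>x. a x * h (b \<bullet> x)) \<zeta>) \<le> (\<integral>s. norm (\<kappa> s * ft a (\<zeta> + (- s / (2 * pi)) *\<^sub>R b)) \<partial>?\<gamma>)"
      by (simp only: integral_norm_bound)
    also have "\<dots> \<le> (\<integral>s. C * D \<zeta> powr (- N) * (1 + \<bar>s\<bar>) ^ Suc k \<partial>?\<gamma>)"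
    proof (rule integral_mono')
      show "integrable ?\<gamma> (\<lambda>s. C * D \<zeta> powr (- N) * (1 + \<bar>s\<bar>) ^ Suc k)"
        using int1[of k] by simp
      show "norm (\<kappa> s * ft a (\<zeta> + (- s / (2 * pi)) *\<^sub>R b)) \<le> C * D \<zeta> powr (- N) * (1 + \<bar>s\<bar>) ^ Suc k" for s
      proof -
        define \<zeta>' where "\<zeta>' = \<zeta> + (- s / (2 * pi)) *\<^sub>R b"
        \<comment> \<open>\<open>D_shift\<close> is used from the shifted point back to \<zeta>: the
          exponent is negative, so a lower bound on \<open>D \<zeta>'\<close> is wanted.\<close>
        have "D \<zeta> \<le> (1 + \<bar>s / (2 * pi)\<bar>) * D \<zeta>'"
          using D_shift[OF b, of \<zeta>' "s / (2 * pi)"] by (simp add: \<zeta>'_def)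
        also have "\<dots> \<le> (1 + \<bar>s\<bar>) * D \<zeta>'"
        proof -
          have "\<bar>s\<bar> * 1 \<le> \<bar>s\<bar> * (2 * pi)" using pi_ge_two by (intro mult_left_mono) auto
          then show ?thesis
            using D_pos[of \<zeta>'] by (intro mult_right_mono) (auto simp: abs_mult divide_le_eq)
        qed
        finally have "((1 + \<bar>s\<bar>) * D \<zeta>') powr (- N) \<le> D \<zeta> powr (- N)"
          using D_pos N by (intro powr_mono2') auto
        then have "(1 + \<bar>s\<bar>) powr (- N) * D \<zeta>' powr (- N) \<le> D \<zeta> powr (- N)"
          by (simp add: powr_mult)
        then have "D \<zeta>' powr (- N) \<le> D \<zeta> powr (- N) * (1 + \<bar>s\<bar>) powr N"
          using mult_left_mono[of _ _ "(1 + \<bar>s\<bar>) powr N"] by (fastforce simp: powr_minus mult_ac)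
        also have "\<dots> \<le> D \<zeta> powr (- N) * (1 + \<bar>s\<bar>) powr real k"
          using k by (intro mult_left_mono powr_mono) auto
        also have "(1 + \<bar>s\<bar>) powr real k = (1 + \<bar>s\<bar>) ^ k"
          by (simp add: powr_realpow)
        finally have 1: "D \<zeta>' powr (- N) \<le> D \<zeta> powr (- N) * (1 + \<bar>s\<bar>) ^ k" .
        have "norm (\<kappa> s * ft a \<zeta>') \<le> (1 + \<bar>s\<bar>) * (C * (D \<zeta> powr (- N) * (1 + \<bar>s\<bar>) ^ k))"
          unfolding norm_mult using \<kappa> C(1) 1
          by (intro mult_mono order_trans[OF C(2)] mult_left_mono) auto
        then show ?thesis
          by (simp add: \<zeta>'_def mult_ac)
      qed
      show "0 \<le> C * D \<zeta> powr (- N) * (1 + \<bar>s\<bar>) ^ Suc k" for s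
        using C(1) by simp
    qed
    also have "\<dots> = C * I * D \<zeta> powr (- N)"
      by (simp add: I_def)
    finally show ?thesis .
  qed
  moreover have "C * I \<ge> 0"
    using C(1) by (auto simp: I_def intro!: mult_nonneg_nonneg integral_nonneg)
  ultimately show ?thesis
    using amp' by (auto simp: decaying_def intro!: exI[of _ "C * I"])
qed

lemma decaying_mult_gaussian:
  assumes "decaying a" "b \<in> Basis"
  shows "decaying (\<lambda>x. a x * of_real (exp (- (b \<bullet> x)\<^sup>2 / 2)))"
  by (rule decaying_mult_fourier_transform[OF assms, of "\<lambda>_. 1" "\<lambda>t. of_real (exp (- t\<^sup>2 / 2))"])
    (auto simp: char_std_normal_cis)

lemma decaying_mult_coordinate_gaussian:
  assumes "decaying a" "b \<in> Basis"
  shows "decaying (\<lambda>x. a x * of_real ((b \<bullet> x) * exp (- (b \<bullet> x)\<^sup>2 / 2)))"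
  by (rule decaying_mult_fourier_transform[OF assms, of "\<lambda>s. - \<i> * s" "\<lambda>t. of_real (t * exp (- t\<^sup>2 / 2))",
        OF _ _ integral_std_normal_times_cis[symmetric]])
    (auto simp: norm_mult)

lemma decaying_mult_gaussians:
  assumes "finite B" "B \<subseteq> Basis" "decaying a"
  shows "decaying (\<lambda>x. a x * of_real (\<Prod>b\<in>B. exp (- (b \<bullet> x)\<^sup>2 / 2)))"
  using assms
proof (induction B)
  case (insert b B)
  then have "decaying (\<lambda>x. a x * of_real (\<Prod>b\<in>B. exp (- (b \<bullet> x)\<^sup>2 / 2)) * of_real (exp (- (b \<bullet> x)\<^sup>2 / 2)))"
    by (intro decaying_mult_gaussian) auto
  then show ?case
    using insert by (simp add: mult_ac)
qed simp

lemma decaying_cmult: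
  assumes "decaying a"
  shows "decaying (\<lambda>x. c * a x)"
proof -
  obtain C where C: "C \<ge> 0" "norm (ft a \<zeta>) \<le> C * D \<zeta> powr (- N)" for \<zeta>
    using assms by (auto simp: decaying_def)
  have "amplitude (\<lambda>x. a x * c)"
    using assms by (intro amplitude_mult[where K="norm c"]) (auto simp: decaying_def)
  moreover have "ft (\<lambda>x. c * a x) \<zeta> = c * ft a \<zeta>" for \<zeta>
    by (simp add: ft_def mult.assoc)
  moreover have "norm (c * ft a \<zeta>) \<le> (norm c * C) * D \<zeta> powr (- N)" for \<zeta>
    unfolding norm_mult mult.assoc by (intro mult_left_mono C) auto
  ultimately show ?thesis
    using C(1) by (auto simp: decaying_def mult.commute[of c] intro!: exI[of _ "norm c * C"])
qed

text \<open>On \<open>S\<close> the product of the one-dimensional Gaussians over all coordinates is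
  the constant exp (- R^2 / 2). So multiplication by one coordinate amounts to the factor exp (R^2 /
  2), the Gaussian times that coordinate, and the plain Gaussians in the remaining ones.\<close>

lemma decaying_mult_coordinate:
  fixes c :: complex
  assumes a: "decaying a" and b: "b \<in> Basis"
  shows "decaying (\<lambda>x. c * of_real (b \<bullet> x) * a x)"
proof -
  let ?g = "\<lambda>b x. exp (- (b \<bullet> x)\<^sup>2 / 2)"
  have "decaying (\<lambda>x. a x * of_real ((b \<bullet> x) * ?g b x) * of_real (\<Prod>b'\<in>Basis - {b}. ?g b' x))"
    using a b by (intro decaying_mult_gaussians decaying_mult_coordinate_gaussian) auto
  then have "decaying (\<lambda>x. (c * of_real (exp (R\<^sup>2 / 2))) * (a x * of_real ((b \<bullet> x) * ?g b x) * of_real (\<Prod>b'\<in>Basis - {b}. ?g b' x)))"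
    by (rule decaying_cmult)
  also have "(\<lambda>x. (c * of_real (exp (R\<^sup>2 / 2))) * (a x * of_real ((b \<bullet> x) * ?g b x) * of_real (\<Prod>b'\<in>Basis - {b}. ?g b' x)))
     = (\<lambda>x. c * of_real (b \<bullet> x) * a x)"
  proof
    fix x
    show "(c * of_real (exp (R\<^sup>2 / 2))) * (a x * of_real ((b \<bullet> x) * ?g b x) * of_real (\<Prod>b'\<in>Basis - {b}. ?g b' x)) = c * of_real (b \<bullet> x) * a x"
    proof (cases "x \<in> S")
      case False
      then have "a x = 0" using a by (simp add: decaying_def amplitude_def)
      then show ?thesis by simp
    next
      case True
      have "?g b x * (\<Prod>b'\<in>Basis - {b}. ?g b' x) = (\<Prod>b'\<in>Basis. ?g b' x)"
        using b by (simp add: prod.remove)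
      also have "\<dots> = exp (\<Sum>b'\<in>Basis. - (b' \<bullet> x)\<^sup>2 / 2)"
        by (simp add: exp_sum)
      also have "(\<Sum>b'\<in>Basis. - (b' \<bullet> x)\<^sup>2 / 2) = - (\<Sum>b'\<in>Basis. (x \<bullet> b')\<^sup>2) / 2"
        by (simp add: sum_negf sum_divide_distrib inner_commute)
      also have "\<dots> = - R\<^sup>2 / 2"
        using S[OF True] by (simp add: sum_inner_orthogonal_transformation_Basis[OF orthogonal_transformation_id])
      finally have "exp (R\<^sup>2 / 2) * (?g b x * (\<Prod>b'\<in>Basis - {b}. ?g b' x)) = 1"
        by (simp flip: exp_add)
      then have "of_real (exp (R\<^sup>2 / 2)) * (of_real (?g b x) * of_real (\<Prod>b'\<in>Basis - {b}. ?g b' x)) = (1 :: complex)"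
        by (metis of_real_1 of_real_mult)
      then have "c * of_real (b \<bullet> x) * a x * (of_real (exp (R\<^sup>2 / 2)) * (of_real (?g b x) * of_real (\<Prod>b'\<in>Basis - {b}. ?g b' x))) = c * of_real (b \<bullet> x) * a x"
        by simp
      then show ?thesis
        by (simp only: of_real_mult mult_ac)
    qed
  qed
  finally show ?thesis .
qed

lemma partial_deriv_ft:
  assumes a: "amplitude a"
  shows "partial_deriv b (ft a) = ft (\<lambda>x. - (of_real (2 * pi) * \<i>) * of_real (b \<bullet> x) * a x)"
proof
  fix \<zeta>
  obtain L where L: "norm (a x) \<le> L" for x
    using a by (auto simp: amplitude_def)
  have L0: "L \<ge> 0" using order_trans[OF norm_ge_zero L[of 0]] .
  have [measurable]: "a \<in> borel_measurable borel"
    using a by (simp add: amplitude_def)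
  have "((\<lambda>t. \<integral>x. a x * cis (- (2 * pi * ((\<zeta> + t *\<^sub>R b) \<bullet> x))) \<partial>\<mu>) has_vector_derivative
      (\<integral>x. - (of_real (2 * pi) * \<i>) * of_real (b \<bullet> x) * a x * cis (- (2 * pi * ((\<zeta> + 0 *\<^sub>R b) \<bullet> x))) \<partial>\<mu>)) (at 0)"
  proof (rule has_vector_derivative_integral[where w="\<lambda>_. 2 * pi * (norm b * \<bar>R\<bar>) * L"
      and f'="\<lambda>t x. - (of_real (2 * pi) * \<i>) * of_real (b \<bullet> x) * a x * cis (- (2 * pi * ((\<zeta> + t *\<^sub>R b) \<bullet> x)))"])
    show "integrable \<mu> (\<lambda>x. a x * cis (- (2 * pi * ((\<zeta> + t *\<^sub>R b) \<bullet> x))))" for t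
      by (rule integrable_const_bound[where B=L]) (use L in \<open>auto simp: norm_mult\<close>)
    have "((\<lambda>t. a x * cis (- (2 * pi * ((\<zeta> + t *\<^sub>R b) \<bullet> x)))) has_vector_derivative
          - (of_real (2 * pi) * \<i>) * of_real (b \<bullet> x) * a x * cis (- (2 * pi * ((\<zeta> + t *\<^sub>R b) \<bullet> x)))) (at t)" for t :: real and x
      using has_vector_derivative_mult_right[OF has_vector_derivative_cis_affine[of "- (2 * pi * (\<zeta> \<bullet> x))" "- (2 * pi * (b \<bullet> x))" t], of "a x"]
      by (simp add: inner_simps algebra_simps)
    then show "AE x in \<mu>. \<forall>t. ((\<lambda>t. a x * cis (- (2 * pi * ((\<zeta> + t *\<^sub>R b) \<bullet> x)))) has_vector_derivative
          - (of_real (2 * pi) * \<i>) * of_real (b \<bullet> x) * a x * cis (- (2 * pi * ((\<zeta> + t *\<^sub>R b) \<bullet> x)))) (at t)"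
      by auto
    have "norm (- (of_real (2 * pi) * \<i>) * of_real (b \<bullet> x) * a x * cis (- (2 * pi * ((\<zeta> + t *\<^sub>R b) \<bullet> x)))) \<le> 2 * pi * (norm b * \<bar>R\<bar>) * L" for t x
    proof (cases "x \<in> S")
      case True
      then have "\<bar>b \<bullet> x\<bar> \<le> norm b * \<bar>R\<bar>"
        using Cauchy_Schwarz_ineq2[of b x] S[OF True] by auto
      then have "2 * pi * \<bar>b \<bullet> x\<bar> * norm (a x) \<le> 2 * pi * (norm b * \<bar>R\<bar>) * L"
        using L[of x] by (intro mult_mono mult_left_mono) auto
      then show ?thesis by (simp add: norm_mult)
    next
      case False
      then have "a x = 0" using a by (simp add: amplitude_def)
      then show ?thesis using L0 by simp
    qed
    then show "AE x in \<mu>. \<forall>t. norm (- (of_real (2 * pi) * \<i>) * of_real (b \<bullet> x) * a x * cis (- (2 * pi * ((\<zeta> + t *\<^sub>R b) \<bullet> x)))) \<le> 2 * pi * (norm b * \<bar>R\<bar>) * L"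
      by auto
  qed auto
  then show "partial_deriv b (ft a) \<zeta> = ft (\<lambda>x. - (of_real (2 * pi) * \<i>) * of_real (b \<bullet> x) * a x) \<zeta>"
    unfolding partial_deriv_def ft_def by (intro vector_derivative_at) simp
qed

text \<open>A derivative changes the amplitude and the constant but keeps \<open>D\<close> and
  \<open>N\<close>; quantifying over the amplitude makes the class closed under
  differentiation.\<close>

definition decays :: "('e \<Rightarrow> complex) \<Rightarrow> bool" where
  "decays f \<longleftrightarrow> (\<exists>a. decaying a \<and> f = ft a)"

lemma decays_partial_deriv:
  fixes b :: 'e
  assumes "decays f" "b \<in> Basis"
  shows "decays (partial_deriv b f)"
proof -
  obtain a where a: "decaying a" "f = ft a"
    using assms(1) by (auto simp: decays_def)
  then have "partial_deriv b f = ft (\<lambda>x. - (of_real (2 * pi) * \<i>) * of_real (b \<bullet> x) * a x)"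
    by (simp add: partial_deriv_ft decaying_def)
  moreover have "decaying (\<lambda>x. - (of_real (2 * pi) * \<i>) * of_real (b \<bullet> x) * a x)"
    by (rule decaying_mult_coordinate[OF a(1) assms(2)])
  ultimately show ?thesis
    unfolding decays_def by blast
qed

lemma decays_multi_deriv:
  fixes \<alpha> :: "'i::finite \<Rightarrow> nat" and e :: "'i \<Rightarrow> 'e"
  assumes f: "decays f" and e: "\<And>i. e i \<in> Basis"
  shows "decays (multi_deriv e \<alpha> f)"
proof -
  have pow: "decays ((partial_deriv (e i) ^^ k) f)" if "decays f" for i k f
    using that by (induction k) (auto intro: decays_partial_deriv e)
  \<comment> \<open>Induction over an arbitrary list covers the enumeration chosen in
    \<open>multi_deriv\<close>.\<close>
  have "decays (fold (\<lambda>i. partial_deriv (e i) ^^ \<alpha> i) is f)" for "is"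
    using f by (induction "is" arbitrary: f) (auto intro: pow)
  then show ?thesis by (simp add: multi_deriv_def)
qed

end

section \<open>The weight \<open>freq_size\<close> and the final estimate\<close>

lemma norm_mult_sin_angle:
  "norm \<xi> * norm \<eta> * \<bar>sin (angle \<xi> \<eta>)\<bar> = area \<xi> \<eta>"
proof (cases "\<xi> = 0 \<or> \<eta> = 0")
  case True
  then show ?thesis
    using area_squared[of \<xi> \<eta>] by auto
next
  case False
  define x where "x = (\<xi> \<bullet> \<eta>) / (norm \<xi> * norm \<eta>)"
  have x: "\<bar>x\<bar> \<le> 1"
    using Cauchy_Schwarz_ineq2[of \<xi> \<eta>] False by (simp add: x_def divide_le_eq)
  have "sin (angle \<xi> \<eta>) = sqrt (1 - x\<^sup>2)"
    unfolding angle_def x_def[symmetric] using x by (intro sin_arccos_abs)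
  then have "(norm \<xi> * norm \<eta> * \<bar>sin (angle \<xi> \<eta>)\<bar>)\<^sup>2 = (norm \<xi> * norm \<eta>)\<^sup>2 * (1 - x\<^sup>2)"
    using x by (simp add: power_mult_distrib abs_square_le_1)
  also have "\<dots> = (area \<xi> \<eta>)\<^sup>2"
    using False unfolding area_squared by (simp add: x_def field_simps)
  finally show ?thesis
    using area_nonneg by (subst (asm) power2_eq_iff_nonneg) auto
qed

lemma area_scaleR: "area (c *\<^sub>R \<xi>) (c *\<^sub>R \<eta>) = c\<^sup>2 * area \<xi> \<eta>"
proof -
  have "(area (c *\<^sub>R \<xi>) (c *\<^sub>R \<eta>))\<^sup>2 = (c\<^sup>2 * area \<xi> \<eta>)\<^sup>2"
    unfolding area_squared power_mult_distrib by (simp add: power_mult_distrib algebra_simps power2_eq_square)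
  then show ?thesis
    using area_nonneg by (subst (asm) power2_eq_iff_nonneg) auto
qed

definition freq_size :: "('a::real_inner) \<times> 'a \<Rightarrow> real" where
  "freq_size \<zeta> = 1 + norm (fst \<zeta>) + norm (snd \<zeta>) + area (fst \<zeta>) (snd \<zeta>)"

lemma freq_size_pos: "freq_size \<zeta> > 0"
  using area_nonneg[of "fst \<zeta>" "snd \<zeta>"] by (simp add: freq_size_def add_pos_nonneg)

text \<open>A basis vector of the product moves only one of the two frequencies, so the area grows
  by at most |s| times the norm of the other one. The growth is therefore linear in s.\<close>

lemma freq_size_shift:
  fixes b :: "('a::euclidean_space) \<times> 'a"
  assumes "b \<in> Basis"
  shows "freq_size (\<zeta> + s *\<^sub>R b) \<le> (1 + \<bar>s\<bar>) * freq_size \<zeta>"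
proof -
  have left: "1 + norm (\<xi> + s *\<^sub>R e) + norm \<eta> + area (\<xi> + s *\<^sub>R e) \<eta> \<le> (1 + \<bar>s\<bar>) * (1 + norm \<xi> + norm \<eta> + area \<xi> \<eta>)"
    if "e \<in> Basis" for e \<xi> \<eta> :: 'a
  proof -
    have "norm (\<xi> + s *\<^sub>R e) \<le> norm \<xi> + \<bar>s\<bar>"
      using norm_triangle_ineq[of \<xi> "s *\<^sub>R e"] that by simp
    moreover have "area (\<xi> + s *\<^sub>R e) \<eta> \<le> area \<xi> \<eta> + \<bar>s\<bar> * norm \<eta>"
      using area_triangle_left[of \<xi> "s *\<^sub>R e" \<eta>] area_le[of "s *\<^sub>R e" \<eta>] that by simp
    moreover have "0 \<le> \<bar>s\<bar> * (norm \<xi> + area \<xi> \<eta>)"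
      by (simp add: area_nonneg)
    ultimately show ?thesis by (simp add: algebra_simps)
  qed
  from assms consider e where "e \<in> Basis" "b = (e, 0)" | e where "e \<in> Basis" "b = (0, e)"
    by (auto simp: Basis_prod_def)
  then show ?thesis
  proof cases
    case 1
    then show ?thesis
      using left[of e "fst \<zeta>" "snd \<zeta>"] by (simp add: freq_size_def)
  next
    case 2
    then show ?thesis
      using left[of e "snd \<zeta>" "fst \<zeta>"]
      by (simp add: freq_size_def area_commute[of "fst \<zeta>"] algebra_simps)
  qed
qed

text \<open>The product of minimum and maximum is |\<xi>| |\<eta>|, and |(\<xi>, \<eta>)| is at most
  twice the maximum. Hence the mixed term of the expanded product is at most twice the area, while
  the linear terms are at most 2 |\<xi>| + |\<eta>|.\<close>

lemma freq_size_ge: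
  "(1 + min (norm \<xi>) (norm \<eta>) * \<bar>sin (angle \<xi> \<eta>)\<bar>) * (1 + norm (\<xi>, \<eta>)) \<le> 2 * freq_size (\<xi>, \<eta>)"
proof -
  define m where "m = min (norm \<xi>) (norm \<eta>) * \<bar>sin (angle \<xi> \<eta>)\<bar>"
  have m0: "m \<ge> 0" by (simp add: m_def)
  have "m \<le> min (norm \<xi>) (norm \<eta>) * 1"
    unfolding m_def by (intro mult_left_mono) auto
  then have m: "m \<le> norm \<xi>" by simp
  have n: "norm (\<xi>, \<eta>) \<le> norm \<xi> + norm \<eta>"
    by (simp add: norm_Pair sqrt_sum_squares_le_sum)
  have "m * (norm \<xi> + norm \<eta>) \<le> m * (2 * max (norm \<xi>) (norm \<eta>))"
    using m0 by (intro mult_left_mono) auto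
  also have "\<dots> = 2 * area \<xi> \<eta>"
    unfolding norm_mult_sin_angle[symmetric] m_def by (simp add: min_def max_def)
  finally have "m * norm (\<xi>, \<eta>) \<le> 2 * area \<xi> \<eta>"
    using mult_left_mono[OF n m0] by linarith
  moreover have "(1 + m) * (1 + k) \<le> 2 * (1 + x + y + w)"
    if "m * k \<le> 2 * w" "m \<le> x" "k \<le> x + y" "0 \<le> y" for k w x y
    using that by (simp add: distrib_left distrib_right)
  ultimately show ?thesis
    using m n unfolding m_def[symmetric] freq_size_def fst_conv snd_conv by (metis norm_ge_zero)
qed

theorem mainTheorem2:
  assumes "CARD('n::finite) \<ge> 3"
  shows "\<forall>(\<alpha> :: 'n \<Rightarrow> nat) (\<beta> :: 'n \<Rightarrow> nat). \<exists>C :: real. \<forall>(\<xi> :: real^'n) (\<eta> :: real^'n).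
    norm (deriv_xi \<alpha> (deriv_eta \<beta> (fourier triangle_measure)) (\<xi>, \<eta>))
      \<le> C * (1 + min (norm \<xi>) (norm \<eta>) * \<bar>sin (angle \<xi> \<eta>)\<bar>) powr (- ((real CARD('n) - 2) / 2))
          * (1 + norm (\<xi>, \<eta>)) powr (- ((real CARD('n) - 2) / 2))"
proof (intro allI)
  fix \<alpha> \<beta> :: "'n \<Rightarrow> nat"
  define N where "N = (real CARD('n) - 2) / 2"
  have N0: "N \<ge> 0" using assms by (simp add: N_def)
  let ?\<mu> = "triangle_measure :: ((real^'n) \<times> (real^'n)) measure"
  interpret finite_measure ?\<mu> by (rule finite_measure_triangle_measure)
  interpret invariant_triangle_measure ?\<mu>
  proof
    show "AE x in ?\<mu>. norm (fst x) = 1 \<and> norm (snd x) = 1 \<and> norm (fst x - snd x) = 1"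
      using AE_triangle_measure by eventually_elim (auto simp: triangles_def)
    show "distr ?\<mu> borel (\<lambda>x. (g (fst x), g (snd x))) = ?\<mu>" if "orthogonal_transformation g" for g
      using that by (rule distr_triangle_measure_orthogonal)
  qed (use assms in auto)
  interpret fourier_decay ?\<mu> triangles "sqrt 2" freq_size N
  proof
    show "norm x = sqrt 2" if "x \<in> triangles" for x :: "(real^'n) \<times> (real^'n)"
      using that by (cases x) (simp add: triangles_def norm_Pair)
  qed (use freq_size_pos freq_size_shift N0 in auto)
  have fourier_eq: "fourier ?\<mu> = ft (indicator triangles)"
  proof
    fix \<zeta> :: "(real^'n) \<times> (real^'n)"
    have [measurable]: "(\<lambda>x. \<zeta> \<bullet> x) \<in> borel_measurable borel" by measurable
    show "fourier ?\<mu> \<zeta> = ft (indicator triangles) \<zeta>"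
      unfolding fourier_def ft_def
    proof (rule integral_cong_AE)
      show "AE x in ?\<mu>. exp (- (2 * complex_of_real pi * \<i> * complex_of_real (\<zeta> \<bullet> x))) =
          indicator triangles x * cis (- (2 * pi * (\<zeta> \<bullet> x)))"
        using AE_triangle_measure by eventually_elim (simp add: cis_conv_exp mult_ac)
    qed measurable
  qed
  obtain C where C: "C \<ge> 0"
    "\<And>\<xi> \<eta>. norm (char_fun \<xi> \<eta>) \<le> C * (1 + norm \<xi> + norm \<eta> + area \<xi> \<eta>) powr (- N)"
    using char_fun_decay[OF distr_triangle_measure_swap] unfolding N_def by auto
  have "norm (fourier ?\<mu> \<zeta>) \<le> C * freq_size \<zeta> powr (- N)" for \<zeta>
  proof -
    \<comment> \<open>The normalizations of \<open>fourier\<close> and \<open>char_fun\<close>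
      differ by this scaling. Norms scale by |c| and the area by c^2, both at least 1, so the weight
      does not decrease.\<close>
    define c where "c = - (2 * pi)"
    have c: "1 \<le> \<bar>c\<bar>" "1 \<le> c\<^sup>2"
      using pi_ge_two one_le_power[of "\<bar>c\<bar>" 2] by (auto simp: c_def)
    have "fourier ?\<mu> \<zeta> = char_fun (c *\<^sub>R fst \<zeta>) (c *\<^sub>R snd \<zeta>)"
      unfolding fourier_def char_fun_def
      by (intro Bochner_Integration.integral_cong) (auto simp: c_def cis_conv_exp inner_prod_def algebra_simps)
    also have "norm \<dots> \<le> C * (1 + norm (c *\<^sub>R fst \<zeta>) + norm (c *\<^sub>R snd \<zeta>) + area (c *\<^sub>R fst \<zeta>) (c *\<^sub>R snd \<zeta>)) powr (- N)"
      by (rule C(2))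
    also have "\<dots> \<le> C * freq_size \<zeta> powr (- N)"
    proof (intro mult_left_mono powr_mono2' freq_size_pos)
      show "freq_size \<zeta> \<le> 1 + norm (c *\<^sub>R fst \<zeta>) + norm (c *\<^sub>R snd \<zeta>) + area (c *\<^sub>R fst \<zeta>) (c *\<^sub>R snd \<zeta>)"
        using mult_right_mono[OF c(1), of "norm (fst \<zeta>)"] mult_right_mono[OF c(1), of "norm (snd \<zeta>)"]
          mult_right_mono[OF c(2) area_nonneg, of "fst \<zeta>" "snd \<zeta>"]
        by (simp add: freq_size_def area_scaleR)
    qed (use C N0 in auto)
    finally show ?thesis .
  qed
  moreover have "amplitude (indicator triangles)"
    by (auto simp: amplitude_def indicator_def intro!: exI[of _ 1])
  ultimately have "decaying (indicator triangles)"
    unfolding decaying_def fourier_eq using C(1) by blast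
  then have "decays (fourier ?\<mu>)"
    unfolding decays_def fourier_eq by blast
  then have "decays (deriv_xi \<alpha> (deriv_eta \<beta> (fourier ?\<mu>)))"
    unfolding deriv_xi_def deriv_eta_def
    by (intro decays_multi_deriv) (auto simp: Basis_prod_def axis_in_Basis_iff)
  then obtain C' where C': "C' \<ge> 0"
    "\<And>\<zeta>. norm (deriv_xi \<alpha> (deriv_eta \<beta> (fourier ?\<mu>)) \<zeta>) \<le> C' * freq_size \<zeta> powr (- N)"
    by (auto simp: decays_def decaying_def)
  have "norm (deriv_xi \<alpha> (deriv_eta \<beta> (fourier ?\<mu>)) (\<xi>, \<eta>))
      \<le> C' * 2 powr N * (1 + min (norm \<xi>) (norm \<eta>) * \<bar>sin (angle \<xi> \<eta>)\<bar>) powr (- N) * (1 + norm (\<xi>, \<eta>)) powr (- N)"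
    for \<xi> \<eta> :: "real^'n"
  proof -
    define P where "P = 1 + min (norm \<xi>) (norm \<eta>) * \<bar>sin (angle \<xi> \<eta>)\<bar>"
    define Q where "Q = 1 + norm (\<xi>, \<eta>)"
    have PQ: "P > 0" "Q > 0"
      by (auto simp: P_def Q_def intro!: add_pos_nonneg)
    have "freq_size (\<xi>, \<eta>) powr (- N) \<le> (P * Q / 2) powr (- N)"
      using freq_size_ge[of \<xi> \<eta>] PQ N0 unfolding P_def[symmetric] Q_def[symmetric]
      by (intro powr_mono2') auto
    also have "\<dots> = 2 powr N * (P powr (- N) * Q powr (- N))"
      using PQ by (simp add: powr_mult powr_divide powr_minus field_simps)
    finally have "C' * freq_size (\<xi>, \<eta>) powr (- N) \<le> C' * (2 powr N * (P powr (- N) * Q powr (- N)))"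
      using C'(1) by (rule mult_left_mono)
    with C'(2)[of "(\<xi>, \<eta>)"] show ?thesis
      unfolding P_def[symmetric] Q_def[symmetric] by (simp add: mult.assoc)
  qed
  then show "\<exists>C. \<forall>(\<xi> :: real^'n) (\<eta> :: real^'n).
    norm (deriv_xi \<alpha> (deriv_eta \<beta> (fourier triangle_measure)) (\<xi>, \<eta>))
      \<le> C * (1 + min (norm \<xi>) (norm \<eta>) * \<bar>sin (angle \<xi> \<eta>)\<bar>) powr (- ((real CARD('n) - 2) / 2))
          * (1 + norm (\<xi>, \<eta>)) powr (- ((real CARD('n) - 2) / 2))"
    unfolding N_def by (intro exI[of _ "C' * 2 powr ((real CARD('n) - 2) / 2)"]) blast
qed

end
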